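(* Let $G$ be a finite group. Then $G$ is solvable if and only if its subgroup lattice $L(G)$ is comodernistic.
   Context: $L(G)$ is the lattice of all subgroups of $G$ ordered by inclusion. An element $m$ of a lattice $L$ is left-modular if $(x\vee m)\wedge y=x\vee(m\wedge y)$ for all $x<y$ in $L$. A lattice is comodernistic if every interval $[u,v]$ has a coatom that is left-modular as an element of the lattice $[u,v]$. *)

theory Defs
  imports "HOL-Algebra.Complete_Lattice" "HOL-Algebra.Solvable_Groups"
begin

text \<open>
  The predicates below are meant for partial orders in the sense of the locale
  \<open>partial_order\<close>, where the equivalence \<open>.=\<close> of the order record is equality.
\<close>

definition left_modular :: "('a, 'b) gorder_scheme \<Rightarrow> 'a \<Rightarrow> bool" where
  "left_modular L m \<longleftrightarrow>
     m \<in> carrier L \<and>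
     (\<forall>x\<in>carrier L. \<forall>y\<in>carrier L. x \<sqsubset>\<^bsub>L\<^esub> y \<longrightarrow>
        (x \<squnion>\<^bsub>L\<^esub> m) \<sqinter>\<^bsub>L\<^esub> y = x \<squnion>\<^bsub>L\<^esub> (m \<sqinter>\<^bsub>L\<^esub> y))"

definition coatom :: "('a, 'b) gorder_scheme \<Rightarrow> 'a \<Rightarrow> bool" where
  "coatom L m \<longleftrightarrow>
     m \<in> carrier L \<and> m \<sqsubset>\<^bsub>L\<^esub> \<top>\<^bsub>L\<^esub> \<and>
     \<not> (\<exists>x\<in>carrier L. m \<sqsubset>\<^bsub>L\<^esub> x \<and> x \<sqsubset>\<^bsub>L\<^esub> \<top>\<^bsub>L\<^esub>)"

definition interval :: "('a, 'b) gorder_scheme \<Rightarrow> 'a \<Rightarrow> 'a \<Rightarrow> ('a, 'b) gorder_scheme" where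
  "interval L u v = L \<lparr> carrier := \<lbrace>u..v\<rbrace>\<^bsub>L\<^esub> \<rparr>"

text \<open>
  Intervals are taken with \<open>u \<noteq> v\<close>: a one-element interval has no coatom, so the condition
  is only meaningful for nontrivial intervals.
\<close>

definition comodernistic :: "('a, 'b) gorder_scheme \<Rightarrow> bool" where
  "comodernistic L \<longleftrightarrow>
     lattice L \<and>
     (\<forall>u\<in>carrier L. \<forall>v\<in>carrier L. u \<sqsubset>\<^bsub>L\<^esub> v \<longrightarrow>
        (\<exists>m. coatom (interval L u v) m \<and> left_modular (interval L u v) m))"

definition subgroup_lattice :: "('a, 'b) monoid_scheme \<Rightarrow> 'a set gorder" where
  "subgroup_lattice G = \<lparr> carrier = {H. subgroup H G}, eq = (=), le = (\<subseteq>) \<rparr>"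

lemma (in group) complete_lattice_subgroup_lattice: "complete_lattice (subgroup_lattice G)"
  unfolding subgroup_lattice_def by (rule subgroups_complete_lattice)

lemma (in group) lattice_subgroup_lattice: "lattice (subgroup_lattice G)"
proof -
  interpret complete_lattice "subgroup_lattice G"
    by (rule complete_lattice_subgroup_lattice)
  show ?thesis by unfold_locales
qed

end

theory Submission
  imports Defs "HOL-Algebra.Multiplicative_Group" "HOL-Computational_Algebra.Primes"
begin

text \<open>
  If \<open>G\<close> is solvable and \<open>H < K\<close> are subgroups, take \<open>N \<lhd> K\<close> minimal with \<open>N H = K\<close> and
  \<open>L \<lhd> K\<close> maximal with \<open>N' \<le> L \<le> N\<close> and \<open>L H \<noteq> K\<close>. Then \<open>L H\<close> is left-modular in \<open>[H, K]\<close> by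
  Dedekind's law. It is a coatom because for \<open>L H \<le> Z < K\<close> the subgroup \<open>Z \<inter> N\<close>, which contains
  \<open>N'\<close>, is normalised by \<open>H\<close> and \<open>N\<close>.

  Conversely, in a minimal counterexample \<open>G\<close> let \<open>N\<close> be a maximal normal subgroup. A left-modular
  coatom of \<open>[N, G]\<close> gives a solvable maximal subgroup \<open>M\<close> of the simple group \<open>G/N\<close> such that every
  conjugate of \<open>M\<close> meets every subgroup \<open>X\<close> in \<open>X\<close> or in a maximal subgroup of \<open>X\<close>. The claim is
  that \<open>M\<close> is trivial, so that \<open>G/N\<close> is cyclic. Otherwise let \<open>A\<close> be a minimal normal subgroup of \<open>M\<close>,
  which is abelian. For \<open>g \<notin> M\<close> put \<open>D = M \<inter> M\<^sup>g\<close>; then \<open>M\<close> is the semidirect product of \<open>A\<close> and \<open>D\<close>,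
  \<open>A\<close> has prime order, and \<open>D\<close> acts faithfully on \<open>A\<close>. If \<open>D\<close> is trivial, then \<open>M\<close> has prime order
  and is self-normalising, and so is some cyclic subgroup avoiding all conjugates of \<open>M\<close>; the
  conjugates of the two contain too many elements. If not, one can choose \<open>g\<close> such that \<open>D\<close> has
  prime order. Then \<open>M\<close> is the union of \<open>A\<close> and the conjugates of \<open>D\<close>, and the normaliser of \<open>D\<close>
  meets any conjugate of \<open>M\<close> that does not contain \<open>D\<close> in a way that leads to a contradiction.
\<close>

subsection \<open>Conjugation, normalisers and centralisers\<close>

context group
begin

definition conj_set :: "'a \<Rightarrow> 'a set \<Rightarrow> 'a set" where
  "conj_set g H = (\<lambda>x. g \<otimes> x \<otimes> inv g) ` H"

definition nrm :: "'a set \<Rightarrow> 'a set" where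
  "nrm H = {g \<in> carrier G. conj_set g H = H}"

definition cent :: "'a set \<Rightarrow> 'a set" where
  "cent H = {g \<in> carrier G. \<forall>x\<in>H. g \<otimes> x = x \<otimes> g}"

lemma inv_mult_cancel [simp]:
  assumes "x \<in> carrier G" "y \<in> carrier G"
  shows "inv x \<otimes> (x \<otimes> y) = y" "x \<otimes> (inv x \<otimes> y) = y"
  using assms by (simp_all flip: m_assoc)

lemmas mult_normalize = m_assoc inv_mult_group

lemma conj_set_subset:
  assumes "g \<in> carrier G" "H \<subseteq> carrier G"
  shows "conj_set g H \<subseteq> carrier G"
  using assms unfolding conj_set_def by auto

lemma mem_conj_set_iff:
  assumes "g \<in> carrier G" "H \<subseteq> carrier G"
  shows "x \<in> conj_set g H \<longleftrightarrow> x \<in> carrier G \<and> inv g \<otimes> x \<otimes> g \<in> H"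
proof
  assume "x \<in> conj_set g H"
  then obtain h where "h \<in> H" "x = g \<otimes> h \<otimes> inv g"
    unfolding conj_set_def by auto
  with assms show "x \<in> carrier G \<and> inv g \<otimes> x \<otimes> g \<in> H"
    by (auto simp: subset_iff mult_normalize)
next
  assume x: "x \<in> carrier G \<and> inv g \<otimes> x \<otimes> g \<in> H"
  then have "x = g \<otimes> (inv g \<otimes> x \<otimes> g) \<otimes> inv g"
    using assms by (simp add: mult_normalize)
  with x show "x \<in> conj_set g H"
    unfolding conj_set_def by blast
qed

lemma conj_setI: "x \<in> H \<Longrightarrow> g \<otimes> x \<otimes> inv g \<in> conj_set g H"
  unfolding conj_set_def by blast

lemma conj_set_mult:
  assumes "g \<in> carrier G" "h \<in> carrier G" "H \<subseteq> carrier G"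
  shows "conj_set g (conj_set h H) = conj_set (g \<otimes> h) H"
  using assms unfolding conj_set_def image_image
  by (intro image_cong) (auto simp: subset_iff mult_normalize)

lemma conj_set_one [simp]:
  assumes "H \<subseteq> carrier G"
  shows "conj_set \<one> H = H"
  using assms unfolding conj_set_def by (force simp: subset_iff image_def)

lemma conj_set_inv_cancel [simp]:
  assumes "g \<in> carrier G" "H \<subseteq> carrier G"
  shows "conj_set g (conj_set (inv g) H) = H" "conj_set (inv g) (conj_set g H) = H"
  using assms by (simp_all add: conj_set_mult)

lemma conj_set_mono: "H \<subseteq> K \<Longrightarrow> conj_set g H \<subseteq> conj_set g K"
  unfolding conj_set_def by blast

lemma conj_set_subset_iff:
  assumes "g \<in> carrier G" "H \<subseteq> carrier G" "K \<subseteq> carrier G"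
  shows "conj_set g H \<subseteq> K \<longleftrightarrow> H \<subseteq> conj_set (inv g) K"
  using assms conj_set_mono[of "conj_set g H" K "inv g"] conj_set_mono[of H "conj_set (inv g) K" g]
  by auto

lemma conj_set_Int:
  assumes "g \<in> carrier G" "H \<subseteq> carrier G" "K \<subseteq> carrier G"
  shows "conj_set g (H \<inter> K) = conj_set g H \<inter> conj_set g K"
  using assms by (auto simp: mem_conj_set_iff le_infI1)

lemma inj_on_conj:
  assumes "g \<in> carrier G"
  shows "inj_on (\<lambda>x. g \<otimes> x \<otimes> inv g) (carrier G)"
  using assms by (auto simp: inj_on_def)

lemma card_conj_set:
  assumes "g \<in> carrier G" "H \<subseteq> carrier G"
  shows "card (conj_set g H) = card H"
  unfolding conj_set_def
  by (rule card_image) (rule inj_on_subset[OF inj_on_conj[OF assms(1)] assms(2)])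

lemma subgroup_conj_set:
  assumes "g \<in> carrier G" "subgroup H G"
  shows "subgroup (conj_set g H) G"
proof -
  have H: "H \<subseteq> carrier G" using assms(2) by (rule subgroup.subset)
  show ?thesis
  proof (rule subgroupI)
    show "conj_set g H \<subseteq> carrier G" using assms(1) H by (rule conj_set_subset)
    show "conj_set g H \<noteq> {}" using subgroup.one_closed[OF assms(2)] unfolding conj_set_def by auto
  next
    fix a assume "a \<in> conj_set g H"
    then obtain h where h: "h \<in> H" "a = g \<otimes> h \<otimes> inv g" unfolding conj_set_def by auto
    then have "inv a = g \<otimes> inv h \<otimes> inv g"
      using assms(1) H by (auto simp: mult_normalize subset_iff)
    then show "inv a \<in> conj_set g H"
      using conj_setI subgroup.m_inv_closed[OF assms(2) h(1)] by simp
  next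
    fix a b assume "a \<in> conj_set g H" "b \<in> conj_set g H"
    then obtain h k where h: "h \<in> H" "a = g \<otimes> h \<otimes> inv g" "k \<in> H" "b = g \<otimes> k \<otimes> inv g"
      unfolding conj_set_def by auto
    then have "a \<otimes> b = g \<otimes> (h \<otimes> k) \<otimes> inv g"
      using assms(1) H by (auto simp: mult_normalize subset_iff)
    then show "a \<otimes> b \<in> conj_set g H"
      using conj_setI subgroup.m_closed[OF assms(2) h(1,3)] by simp
  qed
qed

lemma conj_set_self:
  assumes "subgroup H G" "g \<in> H"
  shows "conj_set g H = H"
proof -
  interpret H: subgroup H G by fact
  have "x \<in> conj_set g H \<longleftrightarrow> x \<in> H" for x
  proof
    assume "x \<in> conj_set g H"
    then show "x \<in> H" using assms(2) by (auto simp: conj_set_def)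
  next
    assume "x \<in> H"
    then show "x \<in> conj_set g H" using assms(2) by (simp add: mem_conj_set_iff H.subset)
  qed
  then show ?thesis by blast
qed

lemma subgroup_nrm:
  assumes "H \<subseteq> carrier G"
  shows "subgroup (nrm H) G"
proof (rule subgroupI)
  show "nrm H \<subseteq> carrier G" unfolding nrm_def by auto
  show "nrm H \<noteq> {}" using assms conj_set_one[OF assms] unfolding nrm_def by blast
next
  fix a assume "a \<in> nrm H"
  then show "inv a \<in> nrm H" using assms conj_set_inv_cancel(2)[of a H] by (simp add: nrm_def)
next
  fix a b assume "a \<in> nrm H" "b \<in> nrm H"
  then show "a \<otimes> b \<in> nrm H" using assms conj_set_mult[of a b H] by (simp add: nrm_def)
qed

lemma subset_nrm:
  assumes "subgroup H G"
  shows "H \<subseteq> nrm H"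
  using assms conj_set_self subgroup.subset unfolding nrm_def by fast

lemma nrm_conj_set:
  assumes "g \<in> carrier G" "H \<subseteq> carrier G"
  shows "nrm (conj_set g H) = conj_set g (nrm H)"
proof -
  have "x \<in> nrm (conj_set g H) \<longleftrightarrow> x \<in> conj_set g (nrm H)" if x: "x \<in> carrier G" for x
  proof -
    have "x \<in> conj_set g (nrm H) \<longleftrightarrow> conj_set (inv g \<otimes> x \<otimes> g) H = H"
      using assms x subgroup.subset[OF subgroup_nrm[OF assms(2)]]
      by (simp add: mem_conj_set_iff) (simp add: nrm_def)
    also have "\<dots> \<longleftrightarrow> conj_set (inv g) (conj_set x (conj_set g H)) = H"
      using assms x by (simp add: conj_set_mult m_assoc conj_set_subset)
    also have "\<dots> \<longleftrightarrow> conj_set x (conj_set g H) = conj_set g H"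
      using assms x by (metis conj_set_inv_cancel conj_set_subset)
    finally show ?thesis using x by (simp add: nrm_def)
  qed
  moreover have "nrm (conj_set g H) \<subseteq> carrier G" "conj_set g (nrm H) \<subseteq> carrier G"
    using conj_set_subset[OF assms(1) subgroup.subset[OF subgroup_nrm[OF assms(2)]]]
    by (simp_all add: nrm_def)
  ultimately show ?thesis by blast
qed

lemma nrm_Int:
  assumes "H \<subseteq> carrier G" "K \<subseteq> carrier G"
  shows "nrm H \<inter> nrm K \<subseteq> nrm (H \<inter> K)"
  using assms by (auto simp: nrm_def conj_set_Int)

lemma nrm_eq_carrier_imp_normal:
  assumes "subgroup H G" "carrier G \<subseteq> nrm H"
  shows "H \<lhd> G"
  unfolding normal_inv_iff using assms(1)
proof (intro conjI ballI)
  fix x h assume "x \<in> carrier G" "h \<in> H"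
  with assms(2) show "x \<otimes> h \<otimes> inv x \<in> H" using conj_setI[of h H x] by (auto simp: nrm_def)
qed

lemma centD: "g \<in> cent H \<Longrightarrow> x \<in> H \<Longrightarrow> x \<otimes> g = g \<otimes> x"
  by (simp add: cent_def)

lemma subgroup_cent:
  assumes "H \<subseteq> carrier G"
  shows "subgroup (cent H) G"
proof (rule subgroupI)
  show "cent H \<subseteq> carrier G" unfolding cent_def by auto
  show "cent H \<noteq> {}" using assms unfolding cent_def by force
next
  fix a assume a: "a \<in> cent H"
  have "inv a \<otimes> x = x \<otimes> inv a" if "x \<in> H" for x
  proof -
    have "x \<in> carrier G" "a \<in> carrier G" "a \<otimes> x = x \<otimes> a" using that assms a by (auto simp: cent_def)
    then show ?thesis by (metis inv_closed inv_mult_group inv_inv inv_solve_left inv_solve_right m_closed m_assoc)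
  qed
  with a show "inv a \<in> cent H" by (auto simp: cent_def)
next
  fix a b assume ab: "a \<in> cent H" "b \<in> cent H"
  have "a \<otimes> b \<otimes> x = x \<otimes> (a \<otimes> b)" if "x \<in> H" for x
  proof -
    have "x \<in> carrier G" "a \<in> carrier G" "a \<otimes> x = x \<otimes> a" "b \<in> carrier G" "b \<otimes> x = x \<otimes> b"
      using that assms ab by (auto simp: cent_def)
    then show ?thesis by (metis m_assoc m_closed)
  qed
  with ab show "a \<otimes> b \<in> cent H" by (auto simp: cent_def)
qed

lemma cent_subset_nrm:
  assumes "H \<subseteq> carrier G"
  shows "cent H \<subseteq> nrm H"
proof
  fix g assume g: "g \<in> cent H"
  have "g \<otimes> x \<otimes> inv g = x" if "x \<in> H" for x
    using that g assms by (auto simp: cent_def m_assoc subset_iff)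
  then have "conj_set g H = H" unfolding conj_set_def by force
  with g show "g \<in> nrm H" by (simp add: nrm_def cent_def)
qed

lemma subset_cent_commute:
  assumes "H \<subseteq> carrier G" "K \<subseteq> carrier G"
  shows "H \<subseteq> cent K \<longleftrightarrow> K \<subseteq> cent H"
  using assms unfolding cent_def by force

text \<open>Conjugation by an element of \<open>nrm H\<close> only permutes the elements of
  \<open>H\<close>, so it preserves the relations that define the centraliser.\<close>

lemma nrm_subset_nrm_cent:
  assumes "H \<subseteq> carrier G"
  shows "nrm H \<subseteq> nrm (cent H)"
proof
  fix g assume "g \<in> nrm H"
  then have g: "g \<in> carrier G" "conj_set g H = H" by (auto simp: nrm_def)
  have C: "cent H \<subseteq> carrier G" by (auto simp: cent_def)
  have sub: "conj_set k (cent H) \<subseteq> cent H" if k: "k \<in> carrier G" "conj_set k H = H" for k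
  proof
    fix x assume "x \<in> conj_set k (cent H)"
    then have x: "x \<in> carrier G" "inv k \<otimes> x \<otimes> k \<in> cent H" using k C by (auto simp: mem_conj_set_iff)
    have "x \<otimes> y = y \<otimes> x" if "y \<in> H" for y
    proof -
      have y: "y \<in> carrier G" using that assms by auto
      have "inv k \<otimes> y \<otimes> k \<in> H" using that k mem_conj_set_iff[OF k(1) assms, of y] by simp
      with x have "inv k \<otimes> x \<otimes> k \<otimes> (inv k \<otimes> y \<otimes> k) = inv k \<otimes> y \<otimes> k \<otimes> (inv k \<otimes> x \<otimes> k)"
        by (simp add: cent_def)
      then have "inv k \<otimes> (x \<otimes> y \<otimes> k) = inv k \<otimes> (y \<otimes> x \<otimes> k)"
        using x y k by (simp add: mult_normalize)
      then show ?thesis using x y k by simp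
    qed
    with x show "x \<in> cent H" by (simp add: cent_def)
  qed
  have "conj_set (inv g) H = H" using g assms by (metis conj_set_inv_cancel(2))
  \<comment> \<open>In a possibly infinite group the reverse inclusion needs the same argument for
    \<open>inv g\<close>.\<close>
  then have "conj_set (inv g) (cent H) \<subseteq> cent H" using sub g by blast
  then have "cent H \<subseteq> conj_set g (cent H)" using g C by (simp add: conj_set_subset_iff)
  with sub[OF g] g show "g \<in> nrm (cent H)" by (auto simp: nrm_def)
qed

text \<open>Moving an element of \<open>D\<close> to the right past an element of \<open>A\<close>
  replaces the latter by a conjugate, which is again in \<open>A\<close>.\<close>

lemma subgroup_set_mult_nrm:
  assumes A: "subgroup A G" and D: "subgroup D G" and "D \<subseteq> nrm A"
  shows "subgroup (A <#> D) G"
proof -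
  interpret A: subgroup A G by fact
  interpret D: subgroup D G by fact
  have nrm: "d \<otimes> a \<otimes> inv d \<in> A" if "d \<in> D" "a \<in> A" for a d
    using that assms(3) conj_setI[of a A d] by (auto simp: nrm_def)
  show ?thesis
  proof (rule subgroupI)
    show "A <#> D \<subseteq> carrier G" by (simp add: A.subset D.subset setmult_subset_G)
    show "A <#> D \<noteq> {}" using A.one_closed D.one_closed unfolding set_mult_def by blast
  next
    fix x assume "x \<in> A <#> D"
    then obtain a d where x: "a \<in> A" "d \<in> D" "x = a \<otimes> d" unfolding set_mult_def by auto
    have "inv x = (inv d \<otimes> inv a \<otimes> inv (inv d)) \<otimes> inv d" using x by (simp add: mult_normalize)
    moreover have "inv d \<otimes> inv a \<otimes> inv (inv d) \<in> A" using x by (intro nrm) auto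
    ultimately show "inv x \<in> A <#> D" using x D.m_inv_closed unfolding set_mult_def by blast
  next
    fix x y assume "x \<in> A <#> D" "y \<in> A <#> D"
    then obtain a d b e where x: "a \<in> A" "d \<in> D" "x = a \<otimes> d" "b \<in> A" "e \<in> D" "y = b \<otimes> e"
      unfolding set_mult_def by auto
    have "x \<otimes> y = a \<otimes> (d \<otimes> b \<otimes> inv d) \<otimes> (d \<otimes> e)" using x by (simp add: mult_normalize)
    moreover have "a \<otimes> (d \<otimes> b \<otimes> inv d) \<in> A" "d \<otimes> e \<in> D" using x nrm by auto
    ultimately show "x \<otimes> y \<in> A <#> D" unfolding set_mult_def by blast
  qed
qed

lemma subset_set_mult:
  assumes "subgroup A G" "subgroup D G"
  shows "A \<subseteq> A <#> D" "D \<subseteq> A <#> D"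
proof -
  interpret A: subgroup A G by fact
  interpret D: subgroup D G by fact
  show "A \<subseteq> A <#> D"
  proof
    fix a assume "a \<in> A"
    then have "a = a \<otimes> \<one>" by simp
    with \<open>a \<in> A\<close> D.one_closed show "a \<in> A <#> D" unfolding set_mult_def by blast
  qed
  show "D \<subseteq> A <#> D"
  proof
    fix a assume "a \<in> D"
    then have "a = \<one> \<otimes> a" by simp
    with \<open>a \<in> D\<close> A.one_closed show "a \<in> A <#> D" unfolding set_mult_def by blast
  qed
qed

lemma set_mult_subset:
  assumes "subgroup K G" "A \<subseteq> K" "D \<subseteq> K"
  shows "A <#> D \<subseteq> K"
  using assms subgroup.m_closed[OF assms(1)] unfolding set_mult_def by auto

end

subsection \<open>Subgroups of prime order\<close>

locale finite_group = group +
  assumes finite_carrier: "finite (carrier G)"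
begin

lemma finite_subgroup: "subgroup H G \<Longrightarrow> finite H"
  using finite_carrier subgroup.subset finite_subset by blast

lemma nrmI:
  assumes "g \<in> carrier G" "H \<subseteq> carrier G" "conj_set g H \<subseteq> H"
  shows "g \<in> nrm H"
proof -
  have "conj_set g H = H"
    using assms card_conj_set finite_carrier by (metis card_subset_eq finite_subset)
  with assms show ?thesis by (simp add: nrm_def)
qed

lemma card_subgroup_dvd:
  assumes "subgroup R G" "subgroup P G" "R \<subseteq> P"
  shows "card R dvd card P"
proof -
  interpret P: group "G\<lparr>carrier := P\<rparr>" by (rule subgroup_imp_group) fact
  have "card (rcosets\<^bsub>G\<lparr>carrier := P\<rparr>\<^esub> R) * card R = order (G\<lparr>carrier := P\<rparr>)"
    using assms by (intro P.lagrange subgroup_incl)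
  then show ?thesis by (simp add: order_def) (metis dvd_triv_right)
qed

lemma prime_card_subgroup_cases:
  assumes "subgroup P G" "prime (card P)" "subgroup R G" "R \<subseteq> P"
  shows "R = {\<one>} \<or> R = P"
proof -
  have "card R dvd card P" using assms card_subgroup_dvd by blast
  then consider "card R = 1" | "card R = card P" using assms(2) prime_nat_iff by blast
  then show ?thesis
  proof cases
    case 1
    then show ?thesis using subgroup.one_closed[OF assms(3)] by (metis card_1_singletonE singletonD)
  next
    case 2
    then show ?thesis using assms finite_subgroup card_subset_eq by blast
  qed
qed

lemma prime_card_ne_one:
  assumes "prime (card P)"
  shows "P \<noteq> {\<one>}"
  using assms by auto

text \<open>By Lagrange, the nontrivial intersection of the two subgroups is all of
  \<open>P\<close>.\<close>

lemma prime_card_eq: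
  assumes "subgroup P G" "prime (card P)" "subgroup R G" "x \<in> P" "x \<in> R" "x \<noteq> \<one>"
  shows "P \<subseteq> R"
proof -
  have "subgroup (P \<inter> R) G" using assms subgroups_Inter_pair by blast
  then show ?thesis using prime_card_subgroup_cases[OF assms(1,2), of "P \<inter> R"] assms(4-6) by blast
qed

lemma generate_singleton_prime:
  assumes "subgroup P G" "prime (card P)" "x \<in> P" "x \<noteq> \<one>"
  shows "generate G {x} = P"
proof -
  have x: "x \<in> carrier G" using assms(1,3) subgroup.subset by blast
  have "subgroup (generate G {x}) G" using x by (intro generate_is_subgroup) auto
  moreover have "generate G {x} \<subseteq> P" using assms by (intro generate_subgroup_incl) auto
  moreover have "x \<in> generate G {x}" by (simp add: generate.incl)
  ultimately show ?thesis using prime_card_subgroup_cases[OF assms(1,2)] assms(4) by blast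
qed

lemma ord_prime_subgroup:
  assumes "subgroup P G" "prime (card P)" "x \<in> P" "x \<noteq> \<one>"
  shows "ord x = card P"
  using assms generate_singleton_prime[OF assms] generate_pow_card[of x] subgroup.subset[OF assms(1)]
  by auto

lemma subgroup_generate_singleton:
  assumes "x \<in> carrier G"
  shows "subgroup (generate G {x}) G" "card (generate G {x}) = ord x" "x \<in> generate G {x}"
  using assms generate_pow_card generate_is_subgroup[of "{x}"] by (auto simp: generate.incl)

lemma generate_singleton_cent:
  assumes "x \<in> carrier G"
  shows "generate G {x} \<subseteq> cent (generate G {x})"
proof -
  have X: "generate G {x} \<subseteq> carrier G"
    using subgroup.subset[OF subgroup_generate_singleton(1)[OF assms]] .
  have "generate G {x} \<subseteq> cent {x}"
    using assms by (intro generate_subgroup_incl subgroup_cent) (auto simp: cent_def)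
  then have "{x} \<subseteq> cent (generate G {x})"
    using subset_cent_commute[of "generate G {x}" "{x}"] X assms by simp
  then show ?thesis using subgroup_cent[OF X] by (rule generate_subgroup_incl)
qed

text \<open>Every nontrivial element generates \<open>P\<close>, so it has order
  \<open>card P\<close>. For a divisor \<open>m\<close> of this number, a power
  \<open>x [^] m\<close> other than \<open>\<one>\<close> has order \<open>card P div m\<close>,
  which forces \<open>m = 1\<close>.\<close>

lemma prime_card_if_minimal:
  assumes P: "subgroup P G" "P \<noteq> {\<one>}"
    and min: "\<And>R. subgroup R G \<Longrightarrow> R \<subseteq> P \<Longrightarrow> R = {\<one>} \<or> R = P"
  shows "prime (card P)"
proof -
  obtain x where x: "x \<in> P" "x \<noteq> \<one>" using P subgroup.one_closed by blast
  then have xc: "x \<in> carrier G" using P subgroup.subset by blast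
  have gen: "generate G {y} = P" if "y \<in> P" "y \<noteq> \<one>" for y
  proof -
    have "y \<in> carrier G" using that P subgroup.subset by blast
    moreover have "generate G {y} \<subseteq> P" using that P by (intro generate_subgroup_incl) auto
    ultimately show ?thesis using subgroup_generate_singleton min that by blast
  qed
  have ord: "ord y = card P" if "y \<in> P" "y \<noteq> \<one>" for y
    using gen[OF that] subgroup_generate_singleton(2)[of y] that P subgroup.subset by fastforce
  have "card P \<noteq> 1" using ord[OF x] ord_eq_1[OF xc] x by simp
  moreover have "card P > 0" using P finite_subgroup subgroup.one_closed card_gt_0_iff by blast
  moreover have "m = 1 \<or> m = card P" if m: "m dvd card P" for m
  proof (cases "x [^] m = \<one>")
    case True
    then have "ord x dvd m" using xc by (simp add: pow_eq_id)
    then show ?thesis using m ord[OF x] by (simp add: dvd_antisym)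
  next
    case False
    have "x [^] m \<in> P"
      using monoid.nat_pow_closed[OF group.is_monoid[OF subgroup_imp_group[OF P(1)]], of x m] x
      by (simp flip: nat_pow_consistent)
    then have "ord (x [^] m) = card P" using ord False by simp
    moreover have "ord (x [^] m) = ord x div m"
      using xc m ord[OF x] \<open>card P > 0\<close> by (intro ord_pow) auto
    ultimately show ?thesis using m ord[OF x] \<open>card P > 0\<close>
      by (metis div_eq_dividend_iff dvd_pos_nat)
  qed
  ultimately show ?thesis by (auto simp: prime_nat_iff)
qed

text \<open>\<open>P\<close> acts on the nontrivial elements of \<open>Q\<close> by conjugation.
  Unless the action is trivial, an orbit has \<open>card P\<close> elements, but only
  \<open>card Q - 1\<close>, which is less, are available.\<close>

lemma prime_card_centralizes:
  assumes P: "subgroup P G" "prime (card P)" and Q: "subgroup Q G" "prime (card Q)"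
    and le: "card Q \<le> card P" and nrm: "P \<subseteq> nrm Q"
  shows "P \<subseteq> cent Q"
proof (rule ccontr)
  assume contra: "\<not> P \<subseteq> cent Q"
  obtain q where q: "q \<in> Q" "q \<noteq> \<one>"
    using subgroup.one_closed[OF Q(1)] prime_card_ne_one[OF Q(2)] by blast
  have PC: "P \<subseteq> carrier G" and QC: "Q \<subseteq> carrier G" using P Q subgroup.subset by auto
  \<comment> \<open>A nontrivial \<open>z\<close> in \<open>P\<close> that commutes with
    \<open>q\<close> forces \<open>P\<close> to commute with \<open>q\<close> and then
    \<open>Q\<close> to commute with \<open>P\<close>, since both orders are prime.\<close>
  have inj: "inj_on (\<lambda>x. x \<otimes> q \<otimes> inv x) P"
  proof (rule inj_onI, rule ccontr)
    fix x y assume xy: "x \<in> P" "y \<in> P" "x \<otimes> q \<otimes> inv x = y \<otimes> q \<otimes> inv y" "x \<noteq> y"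
    have c: "x \<in> carrier G" "y \<in> carrier G" "q \<in> carrier G" using xy q PC QC by auto
    define z where "z = inv y \<otimes> x"
    have z: "z \<in> P" "z \<noteq> \<one>"
      using xy c subgroup.m_closed[OF P(1)] subgroup.m_inv_closed[OF P(1)] unfolding z_def
      by (auto simp: inv_solve_left')
    have "inv y \<otimes> (x \<otimes> q \<otimes> inv x) \<otimes> x = inv y \<otimes> (y \<otimes> q \<otimes> inv y) \<otimes> x" using xy by simp
    then have "z \<otimes> q = q \<otimes> z" using c by (simp add: z_def mult_normalize)
    then have "z \<in> cent {q}" using c by (simp add: cent_def z_def)
    then have "P \<subseteq> cent {q}" using z P c by (intro prime_card_eq[OF P, of _ z] subgroup_cent) auto
    then have "{q} \<subseteq> cent P" using subset_cent_commute[of P "{q}"] PC c by auto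
    then have "Q \<subseteq> cent P" using q PC by (intro prime_card_eq[OF Q, of _ q] subgroup_cent) auto
    with contra show False using subset_cent_commute PC QC by blast
  qed
  have "(\<lambda>x. x \<otimes> q \<otimes> inv x) ` P \<subseteq> Q - {\<one>}"
  proof
    fix y assume "y \<in> (\<lambda>x. x \<otimes> q \<otimes> inv x) ` P"
    then obtain x where x: "x \<in> P" "y = x \<otimes> q \<otimes> inv x" by auto
    then have "y \<in> Q" using nrm conj_setI[OF q(1), of x] by (auto simp: nrm_def)
    moreover have "y \<noteq> \<one>"
    proof
      assume "y = \<one>"
      then have "inv x \<otimes> (x \<otimes> q \<otimes> inv x) \<otimes> x = inv x \<otimes> \<one> \<otimes> x" using x by simp
      moreover have "x \<in> carrier G" "q \<in> carrier G" using x q PC QC by auto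
      ultimately show False using q(2) by (simp add: mult_normalize)
    qed
    ultimately show "y \<in> Q - {\<one>}" by simp
  qed
  then have "card P \<le> card (Q - {\<one>})"
    using inj card_inj_on_le finite_subgroup[OF Q(1)] by blast
  also have "\<dots> < card Q"
    using subgroup.one_closed[OF Q(1)] finite_subgroup[OF Q(1)] by (intro psubset_card_mono) auto
  finally show False using le by simp
qed

text \<open>Double counting of the pairs \<open>(g, y)\<close> with \<open>y\<close> nontrivial in
  \<open>P\<close>, sorted by the value \<open>g \<otimes> y \<otimes> inv g\<close>; each value is
  taken \<open>card P\<close> times. The equation is multiplied out to avoid division.\<close>

lemma card_conjugates_union:
  assumes P: "subgroup P G" "prime (card P)" and self: "nrm P = P"
  shows "card (\<Union>g\<in>carrier G. conj_set g P - {\<one>}) * card P = card (carrier G) * (card P - 1)"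
proof -
  define S where "S = (\<Union>g\<in>carrier G. conj_set g P - {\<one>})"
  define f where "f = (\<lambda>(g, y). g \<otimes> y \<otimes> inv g)"
  define X where "X = carrier G \<times> (P - {\<one>})"
  have PC: "P \<subseteq> carrier G" using P subgroup.subset by blast
  have one: "g \<otimes> y \<otimes> inv g = \<one> \<longleftrightarrow> y = \<one>" if "g \<in> carrier G" "y \<in> carrier G" for g y
    using that by (auto simp: inv_solve_right')
  have S: "S = f ` X"
    unfolding S_def f_def X_def conj_set_def using one PC by (auto simp: image_iff subset_iff)
  have finX: "finite X" using finite_carrier finite_subgroup[OF P(1)] by (simp add: X_def)
  have fib: "card {z \<in> X. f z = s} = card P" if "s \<in> S" for s
  proof -
    from that S obtain g y where gy: "g \<in> carrier G" "y \<in> P" "y \<noteq> \<one>" "s = g \<otimes> y \<otimes> inv g"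
      by (auto simp: f_def X_def)
    have y: "y \<in> carrier G" using gy PC by auto
    \<comment> \<open>The first components of the fibre over \<open>s\<close> form the coset
      \<open>g P\<close>: two of them differ by an element that normalises \<open>P\<close>, hence
      lies in \<open>P\<close>.\<close>
    have "bij_betw (\<lambda>q. (g \<otimes> q, inv q \<otimes> y \<otimes> q)) P {z \<in> X. f z = s}"
    proof (rule bij_betwI')
      fix q r assume "q \<in> P" "r \<in> P"
      then show "((g \<otimes> q, inv q \<otimes> y \<otimes> q) = (g \<otimes> r, inv r \<otimes> y \<otimes> r)) = (q = r)"
        using PC gy by (auto simp: subset_iff)
    next
      fix q assume q: "q \<in> P"
      then have qc: "q \<in> carrier G" using PC by auto
      have "inv q \<otimes> y \<otimes> q \<in> P"
        using q gy P subgroup.m_closed subgroup.m_inv_closed by metis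
      moreover have "inv q \<otimes> y \<otimes> q \<noteq> \<one>" using one[of "inv q" y] qc gy PC by auto
      ultimately show "(g \<otimes> q, inv q \<otimes> y \<otimes> q) \<in> {z \<in> X. f z = s}"
        using gy qc y by (simp add: X_def f_def mult_normalize)
    next
      fix z assume "z \<in> {z \<in> X. f z = s}"
      then obtain h w where z: "z = (h, w)" "h \<in> carrier G" "w \<in> P" "w \<noteq> \<one>" "h \<otimes> w \<otimes> inv h = s"
        by (auto simp: X_def f_def)
      have w: "w \<in> carrier G" using z PC by auto
      define q where "q = inv g \<otimes> h"
      have q: "q \<in> carrier G" using gy z by (simp add: q_def)
      have "q \<otimes> w \<otimes> inv q = inv g \<otimes> (h \<otimes> w \<otimes> inv h) \<otimes> g"
        using z(2) gy(1) w by (simp add: q_def mult_normalize)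
      also have "\<dots> = inv g \<otimes> (g \<otimes> y \<otimes> inv g) \<otimes> g" using z(5) gy(4) by simp
      also have "\<dots> = y" using gy(1) y by (simp add: mult_normalize)
      finally have yq: "y = q \<otimes> w \<otimes> inv q" by simp
      then have "y \<in> conj_set q P" using z conj_setI by blast
      then have "P \<subseteq> conj_set q P" using q P gy by (intro prime_card_eq[OF P, of _ y] subgroup_conj_set)
      then have "conj_set q P = P"
        using card_conj_set[OF q PC] finite_subgroup[OF subgroup_conj_set[OF q P(1)]] card_subset_eq by metis
      then have "q \<in> P" using self q by (auto simp: nrm_def)
      moreover have "z = (g \<otimes> q, inv q \<otimes> y \<otimes> q)"
        using z gy q w yq by (simp add: mult_normalize) (simp add: q_def)
      ultimately show "\<exists>q\<in>P. z = (g \<otimes> q, inv q \<otimes> y \<otimes> q)" by blast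
    qed
    then show ?thesis by (rule bij_betw_same_card[symmetric])
  qed
  have "card X = (\<Sum>s\<in>f ` X. card {z \<in> X. f z = s})"
    using sum.image_gen[OF finX, of "\<lambda>_. 1 :: nat" f] by simp
  also have "\<dots> = card S * card P" using fib by (simp add: S)
  finally show ?thesis
    using subgroup.one_closed[OF P(1)] finite_subgroup[OF P(1)]
    by (simp add: X_def card_cartesian_product S_def)
qed

text \<open>The exact share is \<open>(p - 1) / p\<close> of the group, where
  \<open>p = card P\<close> is at least 2.\<close>

lemma prime_subgroup_conj_union:
  assumes P: "subgroup P G" "prime (card P)" "nrm P = P"
  shows "card (carrier G) \<le> 2 * card (\<Union>g\<in>carrier G. conj_set g P - {\<one>})"
proof -
  let ?S = "\<Union>g\<in>carrier G. conj_set g P - {\<one>}"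
  have p: "card P \<ge> 2" using P(2) by (rule prime_ge_2_nat)
  have "card (carrier G) * card P \<le> card (carrier G) * (2 * (card P - 1))"
    using p by (intro mult_le_mono) auto
  also have "\<dots> = 2 * card ?S * card P" using card_conjugates_union[OF P] by simp
  finally show ?thesis using p by simp
qed

end

subsection \<open>Solvable modular coatoms in simple groups\<close>

text \<open>The last assumption says that \<open>M\<close> is left-modular: for \<open>W\<close> not below the coatom \<open>M\<close>
  the modular law reads \<open>X = W \<squnion> (M \<sqinter> X)\<close>.\<close>

locale simple_group_modular_coatom = finite_group +
  fixes M
  assumes simple: "N \<lhd> G \<Longrightarrow> N = {\<one>} \<or> N = carrier G"
    and M: "subgroup M G" "M \<noteq> carrier G"
    and modular: "subgroup X G \<Longrightarrow> subgroup W G \<Longrightarrow> M \<inter> X \<subseteq> W \<Longrightarrow> W \<subseteq> X \<Longrightarrow> W \<subseteq> M \<or> W = X"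
begin

lemma M_subset: "M \<subseteq> carrier G"
  using M(1) by (rule subgroup.subset)

text \<open>Conjugation is an automorphism of the subgroup lattice. The conjugates give information
  on subgroups of \<open>M\<close> itself, about which the law for \<open>M\<close> says
  nothing.\<close>

lemma modular_conj:
  assumes g: "g \<in> carrier G" and X: "subgroup X G" and W: "subgroup W G"
    and "conj_set g M \<inter> X \<subseteq> W" "W \<subseteq> X"
  shows "W \<subseteq> conj_set g M \<or> W = X"
proof -
  have c: "X \<subseteq> carrier G" "W \<subseteq> carrier G" using X W subgroup.subset by auto
  have "M \<inter> conj_set (inv g) X = conj_set (inv g) (conj_set g M \<inter> X)"
    using g c M_subset by (simp add: conj_set_Int conj_set_subset)
  then have "M \<inter> conj_set (inv g) X \<subseteq> conj_set (inv g) W"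
    using assms(4) conj_set_mono by simp
  then have "conj_set (inv g) W \<subseteq> M \<or> conj_set (inv g) W = conj_set (inv g) X"
    using assms by (intro modular subgroup_conj_set conj_set_mono) auto
  then show ?thesis
    using g c M_subset by (metis conj_set_inv_cancel(1) conj_set_mono)
qed

text \<open>The case \<open>X = carrier G\<close> of the modular law makes \<open>M\<close> a
  maximal subgroup.\<close>

lemma overgroup_cases:
  assumes "subgroup W G" "M \<subseteq> W"
  shows "W = M \<or> W = carrier G"
  using modular[of "carrier G" W] assms M_subset subgroup.subset[OF assms(1)] subgroup_self by blast

lemma normal_subgroup_trivial:
  assumes "subgroup H G" "H \<subseteq> M" "carrier G \<subseteq> nrm H"
  shows "H = {\<one>}"
proof -
  have "H \<lhd> G" using assms by (intro nrm_eq_carrier_imp_normal)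
  moreover have "H \<noteq> carrier G" using assms(2) M M_subset by blast
  ultimately show ?thesis using simple by blast
qed

lemma nrm_eq_M:
  assumes "subgroup H G" "H \<subseteq> M" "H \<noteq> {\<one>}" "M \<subseteq> nrm H"
  shows "nrm H = M"
  using overgroup_cases[of "nrm H"] subgroup_nrm subgroup.subset[OF assms(1)]
    normal_subgroup_trivial[OF assms(1,2)] assms by blast

text \<open>The intersection \<open>K\<close> of all conjugates of \<open>M\<close> is a normal
  subgroup inside \<open>M\<close>, hence trivial by simplicity.\<close>

lemma not_subset_all_conj:
  assumes "H \<noteq> {}" "H \<noteq> {\<one>}"
  shows "\<exists>g\<in>carrier G. \<not> H \<subseteq> conj_set g M"
proof (rule ccontr)
  assume contra: "\<not> ?thesis"
  define K where "K = (\<Inter>g\<in>carrier G. conj_set g M)"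
  have memK: "x \<in> K \<longleftrightarrow> (\<forall>g\<in>carrier G. x \<in> conj_set g M)" for x by (auto simp: K_def)
  have K: "subgroup K G" unfolding K_def
    using M subgroup_conj_set by (intro subgroups_Inter) auto
  have "K \<subseteq> conj_set \<one> M" unfolding K_def by blast
  then have KM: "K \<subseteq> M" using M_subset by simp
  have "carrier G \<subseteq> nrm K"
  proof
    fix g assume g: "g \<in> carrier G"
    have "conj_set g K \<subseteq> conj_set h M" if h: "h \<in> carrier G" for h
    proof -
      have "K \<subseteq> conj_set (inv g \<otimes> h) M" using g h unfolding K_def by blast
      then have "conj_set g K \<subseteq> conj_set g (conj_set (inv g \<otimes> h) M)" by (rule conj_set_mono)
      then show ?thesis using g h M_subset by (simp add: conj_set_mult)
    qed
    then have "conj_set g K \<subseteq> K" using memK by blast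
    then show "g \<in> nrm K" using g KM M_subset by (intro nrmI) auto
  qed
  then have "K = {\<one>}" using K KM normal_subgroup_trivial by blast
  moreover have "H \<subseteq> K" using contra memK by blast
  ultimately show False using assms by blast
qed

end

section \<open>A minimal normal subgroup of the coatom, assumed abelian\<close>

locale simple_group_modular_coatom_abelian = simple_group_modular_coatom +
  fixes A
  assumes A: "subgroup A G" "A \<subseteq> M" "A \<noteq> {\<one>}" "M \<subseteq> nrm A" "A \<subseteq> cent A"
    and A_minimal: "subgroup B G \<Longrightarrow> B \<subseteq> A \<Longrightarrow> B \<noteq> {\<one>} \<Longrightarrow> M \<subseteq> nrm B \<Longrightarrow> B = A"
begin

abbreviation D :: "'a \<Rightarrow> 'a set" where "D g \<equiv> M \<inter> conj_set g M"

lemma A_subset: "A \<subseteq> carrier G"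
  using A(1) by (rule subgroup.subset)

lemma nrm_A: "nrm A = M"
  using A nrm_eq_M by blast

lemma subgroup_D: "g \<in> carrier G \<Longrightarrow> subgroup (D g) G"
  using M(1) subgroup_conj_set subgroups_Inter_pair by blast

text \<open>The modular law for the conjugate, applied inside \<open>M\<close>: the product contains
  \<open>D g\<close> but is not contained in the conjugate.\<close>

lemma M_eq_set_mult:
  assumes g: "g \<in> carrier G" and not: "\<not> A \<subseteq> conj_set g M"
  shows "M = A <#> D g"
proof -
  have sub: "subgroup (A <#> D g) G"
    using A nrm_A g by (intro subgroup_set_mult_nrm subgroup_D) auto
  moreover have "A <#> D g \<subseteq> M" using M(1) A(2) by (intro set_mult_subset) auto
  moreover have "A \<subseteq> A <#> D g" "D g \<subseteq> A <#> D g"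
    using subset_set_mult A subgroup_D g by blast+
  ultimately show ?thesis using modular_conj[OF g M(1) sub] not by blast
qed

text \<open>The intersection is normalised by \<open>A\<close>, which is abelian, and by
  \<open>D g\<close>, hence by their product \<open>M\<close>. By minimality it is trivial or all of
  \<open>A\<close>.\<close>

lemma A_Int_conj:
  assumes g: "g \<in> carrier G" and not: "\<not> A \<subseteq> conj_set g M"
  shows "A \<inter> conj_set g M = {\<one>}"
proof (rule ccontr)
  assume contra: "A \<inter> conj_set g M \<noteq> {\<one>}"
  have eq: "A \<inter> conj_set g M = A \<inter> D g" using A(2) by blast
  have sub: "subgroup (A \<inter> D g) G" using A(1) subgroup_D g subgroups_Inter_pair by blast
  have c: "D g \<subseteq> carrier G" using M_subset by blast
  have "A \<subseteq> cent (A \<inter> D g)" using A(5) by (auto simp: cent_def)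
  then have "A \<subseteq> nrm (A \<inter> D g)" using cent_subset_nrm[of "A \<inter> D g"] A_subset by blast
  moreover have "D g \<subseteq> nrm (A \<inter> D g)"
    using nrm_Int[OF A_subset c] subset_nrm[OF subgroup_D[OF g]] nrm_A by blast
  ultimately have "A <#> D g \<subseteq> nrm (A \<inter> D g)"
    using subgroup.subset[OF sub] by (intro set_mult_subset subgroup_nrm)
  then have "M \<subseteq> nrm (A \<inter> D g)" using M_eq_set_mult assms by simp
  then have "A \<inter> D g = A" using A_minimal sub contra eq by auto
  then show False using not by blast
qed

text \<open>Some conjugate of \<open>M\<close> meets \<open>A\<close> trivially. By modularity, a
  subgroup of \<open>A\<close> lies in this conjugate, and is then trivial, or is all of
  \<open>A\<close>.\<close>

lemma prime_card_A: "prime (card A)"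
proof -
  obtain g where g: "g \<in> carrier G" "\<not> A \<subseteq> conj_set g M"
    using not_subset_all_conj A(3) subgroup.one_closed[OF A(1)] by blast
  show ?thesis
  proof (rule prime_card_if_minimal[OF A(1) A(3)])
    fix R assume R: "subgroup R G" "R \<subseteq> A"
    then have "conj_set g M \<inter> A \<subseteq> R" using A_Int_conj[OF g] subgroup.one_closed[OF R(1)] by (simp add: Int_commute)
    then have "R \<subseteq> conj_set g M \<or> R = A" using modular_conj[OF g(1) A(1) R(1)] R(2) by blast
    then show "R = {\<one>} \<or> R = A" using A_Int_conj[OF g] R(2) subgroup.one_closed[OF R(1)] by blast
  qed
qed

lemma conj_A:
  assumes "g \<in> carrier G"
  shows "subgroup (conj_set g A) G" "card (conj_set g A) = card A" "conj_set g A \<subseteq> carrier G"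
    "nrm (conj_set g A) = conj_set g M"
  using assms A_subset A(1)
  by (simp_all add: card_conj_set subgroup_conj_set nrm_conj_set nrm_A conj_set_subset)

text \<open>Let \<open>B\<close> be the conjugate of \<open>A\<close> by \<open>g\<close>, and
  \<open>C\<close> the centraliser of \<open>A\<close> and \<open>B\<close> in \<open>D g\<close>.
  It is normalised by \<open>M\<close> and by \<open>B\<close>, which together generate the group,
  so it is trivial. But \<open>P\<close> normalises \<open>A\<close> and \<open>B\<close>, so by its
  order it centralises both and lies in \<open>C\<close>.\<close>

lemma prime_subgroup_D_card:
  assumes g: "g \<in> carrier G" and not: "\<not> A \<subseteq> conj_set g M"
    and P: "subgroup P G" "P \<subseteq> D g" "card P = card A"
  shows False
proof -
  define B where "B = conj_set g A"
  have B: "subgroup B G" "card B = card A" "B \<subseteq> carrier G" "nrm B = conj_set g M"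
    unfolding B_def using conj_A[OF g] .
  have PC: "P \<subseteq> carrier G" using P(1) by (rule subgroup.subset)
  have prime: "prime (card A)" by (rule prime_card_A)
  define C where "C = (D g \<inter> cent A) \<inter> (D g \<inter> cent B)"
  have sC: "subgroup (cent A) G" "subgroup (cent B) G" using A_subset B by (auto intro: subgroup_cent)
  have C: "subgroup C G" "C \<subseteq> M" "C \<subseteq> carrier G"
    unfolding C_def using sC subgroup_D[OF g] subgroups_Inter_pair M_subset by blast+
  \<comment> \<open>Otherwise \<open>A\<close> and \<open>B\<close>, of equal prime order, would
    commute, and \<open>A\<close> would lie in the normaliser of \<open>B\<close>, the conjugate of
    \<open>M\<close>.\<close>
  have nB: "\<not> B \<subseteq> M"
  proof
    assume "B \<subseteq> M"
    then have "B \<subseteq> cent A" using A B prime nrm_A by (intro prime_card_centralizes) auto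
    then have "A \<subseteq> cent B" using subset_cent_commute A_subset B by blast
    then have "A \<subseteq> nrm B" using cent_subset_nrm B by blast
    then show False using B not by simp
  qed
  have "D g \<subseteq> nrm (D g)" using subset_nrm subgroup_D g by blast
  moreover have "D g \<subseteq> nrm (cent A)" using nrm_subset_nrm_cent[OF A_subset] nrm_A by blast
  moreover have "D g \<subseteq> nrm (cent B)" using nrm_subset_nrm_cent[OF B(3)] B(4) by blast
  moreover have "nrm (D g) \<inter> nrm (cent A) \<subseteq> nrm (D g \<inter> cent A)"
    "nrm (D g) \<inter> nrm (cent B) \<subseteq> nrm (D g \<inter> cent B)"
    "nrm (D g \<inter> cent A) \<inter> nrm (D g \<inter> cent B) \<subseteq> nrm C"
    unfolding C_def using M_subset sC[THEN subgroup.subset] by (intro nrm_Int; blast)+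
  ultimately have "D g \<subseteq> nrm C" by blast
  moreover have "A \<subseteq> nrm C"
  proof -
    have "C \<subseteq> cent A" by (auto simp: C_def)
    then have "A \<subseteq> cent C" using subset_cent_commute A_subset C by blast
    then show ?thesis using cent_subset_nrm C by blast
  qed
  ultimately have "A <#> D g \<subseteq> nrm C" using C by (intro set_mult_subset subgroup_nrm)
  then have MN: "M \<subseteq> nrm C" using M_eq_set_mult g not by simp
  have "B \<subseteq> nrm C"
  proof -
    have "C \<subseteq> cent B" by (auto simp: C_def)
    then have "B \<subseteq> cent C" using subset_cent_commute B C by blast
    then show ?thesis using cent_subset_nrm C by blast
  qed
  with nB MN have "nrm C = carrier G" using overgroup_cases[of "nrm C"] C subgroup_nrm by blast
  then have "C = {\<one>}" using C normal_subgroup_trivial by simp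
  moreover have "P \<subseteq> cent A" using P A prime nrm_A by (intro prime_card_centralizes) auto
  moreover have "P \<subseteq> cent B" using P B prime by (intro prime_card_centralizes) auto
  ultimately have "P \<subseteq> {\<one>}" using P(2) unfolding C_def by blast
  then have "card P \<le> 1" using card_mono[of "{\<one>}" P] by simp
  then show False using prime P by (auto dest: prime_gt_1_nat)
qed

text \<open>\<open>P\<close> centralises \<open>A\<close>. If \<open>x = a \<otimes> d\<close> with
  \<open>d\<close> in \<open>D g\<close>, then \<open>a\<close> and \<open>x\<close> commute, so the
  order of \<open>d\<close> divides \<open>card A\<close>, and \<open>prime_subgroup_D_card\<close>
  leaves only \<open>d = \<one>\<close>.\<close>

lemma prime_subgroup_M_eq:
  assumes P: "subgroup P G" "P \<subseteq> M" "card P = card A"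
  shows "P = A"
proof -
  obtain g where g: "g \<in> carrier G" "\<not> A \<subseteq> conj_set g M"
    using not_subset_all_conj A(3) subgroup.one_closed[OF A(1)] by blast
  have PC: "P \<subseteq> carrier G" using P(1) by (rule subgroup.subset)
  have prime: "prime (card A)" by (rule prime_card_A)
  have cent: "P \<subseteq> cent A" using P A prime nrm_A by (intro prime_card_centralizes) auto
  have "x \<in> A" if x: "x \<in> P" for x
  proof -
    obtain a d where ad: "a \<in> A" "d \<in> D g" "x = a \<otimes> d"
      using x P(2) M_eq_set_mult[OF g] unfolding set_mult_def by blast
    have c: "a \<in> carrier G" "d \<in> carrier G" "x \<in> carrier G" using ad x PC A_subset M_subset by auto
    have pow: "y [^] card Q = \<one>" if "subgroup Q G" "y \<in> Q" for Q y
      using group.pow_order_eq_1[OF subgroup_imp_group[OF that(1)], of y] that(2)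
      by (simp add: order_def flip: nat_pow_consistent)
    have d: "d = inv a \<otimes> x" using ad c by simp
    have ia: "inv a \<in> A" using ad subgroup.m_inv_closed[OF A(1)] by blast
    then have "inv a \<otimes> x = x \<otimes> inv a" using centD[of x A] ia cent x by blast
    then have "d [^] card A = inv a [^] card A \<otimes> x [^] card A"
      unfolding d using c by (intro pow_mult_distrib) auto
    also have "\<dots> = \<one>" using pow[OF A(1) ia] pow[OF P(1) x] P(3) by simp
    finally have "ord d dvd card A" using c by (simp add: pow_eq_id)
    then have "ord d = 1 \<or> ord d = card A" using prime prime_nat_iff by blast
    moreover have "ord d \<noteq> card A"
    proof
      assume "ord d = card A"
      moreover have "generate G {d} \<subseteq> D g" using ad subgroup_D g by (intro generate_subgroup_incl) auto
      ultimately show False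
        using prime_subgroup_D_card[OF g] subgroup_generate_singleton[OF c(2)] by auto
    qed
    ultimately have "d = \<one>" using ord_eq_1 c by blast
    then show ?thesis using ad c by simp
  qed
  then show ?thesis using card_subset_eq[of A P] finite_subgroup[OF A(1)] P(3) by blast
qed

text \<open>Conjugating back gives a subgroup of \<open>M\<close> of order \<open>card A\<close>,
  which must be \<open>A\<close>; so \<open>inv h\<close> would normalise \<open>A\<close>. The
  results on \<open>g\<close> thereby apply to every element outside \<open>M\<close>.\<close>

lemma not_A_subset_conj:
  assumes h: "h \<in> carrier G" "h \<notin> M"
  shows "\<not> A \<subseteq> conj_set h M"
proof
  assume "A \<subseteq> conj_set h M"
  then have "conj_set (inv h) A \<subseteq> M" using h A_subset M_subset by (simp add: conj_set_subset_iff)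
  then have "conj_set (inv h) A = A" using conj_A[of "inv h"] h prime_subgroup_M_eq by simp
  then have "inv h \<in> M" using nrm_A h by (auto simp: nrm_def)
  then show False using h subgroup.m_inv_closed[OF M(1), of "inv h"] by simp
qed

lemma A_Int_conj_M:
  assumes "h \<in> carrier G" "h \<notin> M"
  shows "A \<inter> conj_set h M = {\<one>}"
  using assms not_A_subset_conj A_Int_conj by blast

lemma M_factorize:
  assumes "h \<in> carrier G" "h \<notin> M" "x \<in> M"
  obtains a d where "a \<in> A" "d \<in> D h" "x = a \<otimes> d"
  using that assms(3) M_eq_set_mult[OF assms(1) not_A_subset_conj[OF assms(1,2)]]
  unfolding set_mult_def by blast

text \<open>Faithfulness of the action of \<open>D h\<close> on \<open>A\<close>. Otherwise some
  centralising \<open>c\<close> lies outside a conjugate of \<open>M\<close>, and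
  \<open>c = a \<otimes> d\<close> with respect to that conjugate. As \<open>a\<close> and
  \<open>c\<close> commute, \<open>inv a [^] ord c\<close> lies in both \<open>A\<close> and
  \<open>D k\<close>, so it is trivial. Hence \<open>card A\<close> divides \<open>ord c\<close>,
  and a power of \<open>c\<close> generates a subgroup excluded by
  \<open>prime_subgroup_D_card\<close>.\<close>

lemma D_Int_cent_A:
  assumes h: "h \<in> carrier G" "h \<notin> M"
  shows "D h \<inter> cent A = {\<one>}"
proof (rule ccontr)
  assume contra: "D h \<inter> cent A \<noteq> {\<one>}"
  have "D h \<inter> cent A \<noteq> {}"
    using subgroup.one_closed[OF subgroup_D[OF h(1)]] subgroup.one_closed[OF subgroup_cent[OF A_subset]]
    by blast
  then obtain k where k: "k \<in> carrier G" "\<not> D h \<inter> cent A \<subseteq> conj_set k M"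
    using contra not_subset_all_conj by blast
  have kM: "k \<notin> M" using k conj_set_self[OF M(1)] by blast
  obtain c where c: "c \<in> D h" "c \<in> cent A" "c \<notin> conj_set k M" using k by blast
  then obtain a d where ad: "a \<in> A" "d \<in> D k" "c = a \<otimes> d" using k kM M_factorize by blast
  have car: "a \<in> carrier G" "d \<in> carrier G" "c \<in> carrier G" using ad c A_subset M_subset by auto
  have ia: "inv a \<in> A" using ad subgroup.m_inv_closed[OF A(1)] by blast
  have na: "inv a \<noteq> \<one>" using c ad car by (auto simp: inv_eq_1_iff)
  have d: "d = inv a \<otimes> c" using ad car by simp
  have "inv a \<otimes> c = c \<otimes> inv a" using centD[of c A] ia c by blast
  then have "d [^] ord c = inv a [^] ord c \<otimes> c [^] ord c"
    unfolding d using car by (intro pow_mult_distrib) auto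
  then have eq: "d [^] ord c = inv a [^] ord c" using car by simp
  have pow: "y [^] n \<in> Q" if "subgroup Q G" "y \<in> Q" for Q y and n :: nat
    using monoid.nat_pow_closed[OF group.is_monoid[OF subgroup_imp_group[OF that(1)]], of y n] that(2)
    by (simp flip: nat_pow_consistent)
  have "inv a [^] ord c \<in> A" using pow[OF A(1) ia] .
  moreover have "inv a [^] ord c \<in> D k" using pow[OF subgroup_D[OF k(1)] ad(2)] eq by metis
  ultimately have "inv a [^] ord c = \<one>" using A_Int_conj_M[OF k(1) kM] by blast
  then have "ord (inv a) dvd ord c" using car by (simp add: pow_eq_id)
  then have dvd: "card A dvd ord c" using ord_prime_subgroup[OF A(1) prime_card_A ia na] by simp
  have "ord c > 0" using ord_ge_1[OF finite_carrier car(3)] by simp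
  define m where "m = ord c div card A"
  have m: "m dvd ord c" "m \<noteq> 0" "ord c div m = card A"
    using dvd \<open>ord c > 0\<close> unfolding m_def by (auto elim!: dvdE)
  then have "ord (c [^] m) = card A" using car ord_pow by simp
  moreover have "generate G {c [^] m} \<subseteq> D h"
    using pow[OF subgroup_D[OF h(1)] c(1)] subgroup_D[OF h(1)] by (intro generate_subgroup_incl) auto
  ultimately show False
    using prime_subgroup_D_card[OF h(1) not_A_subset_conj[OF h]]
      subgroup_generate_singleton[of "c [^] m"] car by auto
qed

end

section \<open>Contradiction from the semidirect product structure of the coatom\<close>

context simple_group_modular_coatom_abelian
begin

text \<open>Some \<open>x\<close> lies in no conjugate of \<open>M\<close>, and the cyclic group
  \<open>X\<close> generated by it again has prime order and is self-normalising. The nontrivial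
  elements of the conjugates of \<open>M\<close> and of \<open>X\<close> form two disjoint sets,
  each of at least half the group order, which leaves no room for \<open>\<one>\<close>.\<close>

lemma prime_card_M_False:
  assumes p: "prime (card M)"
  shows False
proof -
  have ne: "M \<noteq> {\<one>}" using p by (rule prime_card_ne_one)
  have nM: "nrm M = M" using nrm_eq_M[OF M(1)] ne subset_nrm M by blast
  define S where "S P = (\<Union>g\<in>carrier G. conj_set g P - {\<one>})" for P
  have SC: "S P \<subseteq> carrier G - {\<one>}" if "subgroup P G" for P
    using conj_set_subset subgroup.subset[OF that] unfolding S_def by blast
  \<comment> \<open>If the conjugates covered the group, the counting formula would give
    \<open>card (carrier G) = card M\<close>.\<close>
  have "S M \<noteq> carrier G - {\<one>}"
  proof
    assume eq: "S M = carrier G - {\<one>}"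
    have "card (S M) = card (carrier G) - 1" unfolding eq using finite_carrier by simp
    then have "(card (carrier G) - 1) * card M = card (carrier G) * (card M - 1)"
      using card_conjugates_union[OF M(1) p nM] by (simp add: S_def)
    moreover have "card (carrier G) \<ge> card M" using card_mono finite_carrier M_subset by blast
    moreover have "card M > 0" using p prime_gt_0_nat by blast
    ultimately have "card M * card (carrier G) - card M = card M * card (carrier G) - card (carrier G)"
      "card M \<le> card M * card (carrier G)" "card (carrier G) \<le> card M * card (carrier G)"
      by (simp_all add: algebra_simps)
    then have "card (carrier G) = card M" by linarith
    then show False using card_subset_eq[OF finite_carrier M_subset] M(2) by simp
  qed
  then obtain x where x: "x \<in> carrier G" "x \<noteq> \<one>" "x \<notin> S M" using SC[OF M(1)] by blast
  have notconj: "x \<notin> conj_set g M" if "g \<in> carrier G" for g using x that by (auto simp: S_def)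
  then have xM: "x \<notin> M" using conj_set_one[OF M_subset] one_closed by metis
  define X where "X = generate G {x}"
  have X: "subgroup X G" "x \<in> X" using subgroup_generate_singleton x by (auto simp: X_def)
  \<comment> \<open>A nontrivial intersection would put \<open>M\<close> into \<open>X\<close>, so
    that the whole group would be cyclic and \<open>M\<close> normal.\<close>
  have triv: "M \<inter> X = {\<one>}"
  proof (rule ccontr)
    assume "M \<inter> X \<noteq> {\<one>}"
    moreover have "subgroup (M \<inter> X) G" using M X subgroups_Inter_pair by blast
    ultimately have "M \<subseteq> X" using prime_card_subgroup_cases[OF M(1) p, of "M \<inter> X"] by blast
    then have XG: "X = carrier G" using overgroup_cases[OF X(1)] X xM by blast
    have "X \<subseteq> cent X" unfolding X_def using x(1) by (rule generate_singleton_cent)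
    then have "carrier G \<subseteq> cent M" using XG M_subset by (auto simp: cent_def)
    then have "carrier G \<subseteq> nrm M" using cent_subset_nrm M_subset by blast
    then show False using nM M M_subset by blast
  qed
  have pX: "prime (card X)"
  proof (rule prime_card_if_minimal[OF X(1)])
    show "X \<noteq> {\<one>}" using X x by blast
  next
    fix R assume R: "subgroup R G" "R \<subseteq> X"
    then have "R \<subseteq> M \<or> R = X" using modular[OF X(1) R(1)] triv subgroup.one_closed[OF R(1)] by simp
    then show "R = {\<one>} \<or> R = X" using R(2) triv subgroup.one_closed[OF R(1)] by blast
  qed
  have XC: "X \<subseteq> carrier G" using X(1) by (rule subgroup.subset)
  have sN: "subgroup (nrm X) G" using XC by (rule subgroup_nrm)
  have XN: "X \<subseteq> nrm X" using X(1) by (rule subset_nrm)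
  \<comment> \<open>If \<open>M\<close> meets \<open>nrm X\<close> trivially, modularity applies.
    Otherwise \<open>M\<close> and \<open>x\<close> both normalise \<open>X\<close>, so
    \<open>X\<close> is normal in a simple group, which is incompatible with
    \<open>triv\<close>.\<close>
  have nX: "nrm X = X"
  proof (cases "M \<inter> nrm X = {\<one>}")
    case True
    then have "X \<subseteq> M \<or> X = nrm X" using modular[OF sN X(1)] XN subgroup.one_closed[OF X(1)] by simp
    then show ?thesis using X xM by blast
  next
    case False
    moreover have "subgroup (M \<inter> nrm X) G" using M sN subgroups_Inter_pair by blast
    ultimately have "M \<subseteq> nrm X" using prime_card_subgroup_cases[OF M(1) p, of "M \<inter> nrm X"] by blast
    then have "nrm X = carrier G" using overgroup_cases[OF sN] XN X xM by blast
    then have "X \<lhd> G" using X by (intro nrm_eq_carrier_imp_normal) auto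
    then have "X = carrier G" using simple prime_card_ne_one[OF pX] by blast
    then have "M \<inter> X = M" using M_subset by blast
    then show ?thesis using triv ne by simp
  qed
  have disj: "S M \<inter> S X = {}"
  proof (rule ccontr)
    assume "S M \<inter> S X \<noteq> {}"
    then obtain y g h where y: "g \<in> carrier G" "h \<in> carrier G" "y \<in> conj_set g M" "y \<in> conj_set h X" "y \<noteq> \<one>"
      by (auto simp: S_def)
    have "conj_set h X \<subseteq> conj_set g M"
      using y subgroup_conj_set X M card_conj_set[OF y(2) XC] pX
      by (intro prime_card_eq[of _ _ y]) auto
    then have "X \<subseteq> conj_set (inv h) (conj_set g M)"
      using conj_set_subset_iff[of h X "conj_set g M"] y XC conj_set_subset[OF y(1) M_subset] by simp
    then have "X \<subseteq> conj_set (inv h \<otimes> g) M" using y M_subset by (simp add: conj_set_mult)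
    then show False using notconj[of "inv h \<otimes> g"] X(2) y by auto
  qed
  have fin: "finite (S P)" if "subgroup P G" for P
    using SC[OF that] finite_carrier finite_subset by blast
  have "card (S M) + card (S X) = card (S M \<union> S X)"
    using disj fin M X by (simp add: card_Un_disjoint)
  also have "\<dots> \<le> card (carrier G - {\<one>})"
    using SC[OF M(1)] SC[OF X(1)] finite_carrier by (intro card_mono) auto
  also have "\<dots> < card (carrier G)"
    using finite_carrier by (intro psubset_card_mono) auto
  finally show False
    using prime_subgroup_conj_union[OF M(1) p nM] prime_subgroup_conj_union[OF X(1) pX nX]
    by (simp add: S_def)
qed

lemma D_nontrivial:
  assumes h: "h \<in> carrier G" "h \<notin> M"
  shows "D h \<noteq> {\<one>}"
proof
  assume D: "D h = {\<one>}"
  have "M \<subseteq> A"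
  proof
    fix x assume "x \<in> M"
    then obtain a d where "a \<in> A" "d \<in> D h" "x = a \<otimes> d" using M_factorize[OF h] by blast
    with D A_subset show "x \<in> A" by auto
  qed
  then have "M = A" using A(2) by blast
  then show False using prime_card_A prime_card_M_False by simp
qed

lemma commuting_trivial:
  assumes h: "h \<in> carrier G" "h \<notin> M" and a: "a \<in> A" "a \<noteq> \<one>" and d: "d \<in> D h" "d \<otimes> a = a \<otimes> d"
  shows "d = \<one>"
proof -
  have c: "a \<in> carrier G" "d \<in> carrier G" using a d A_subset M_subset by auto
  then have "a \<in> cent {d}" using d by (simp add: cent_def)
  then have "A \<subseteq> cent {d}" using a c by (intro prime_card_eq[OF A(1) prime_card_A, of _ a] subgroup_cent) auto
  then have "{d} \<subseteq> cent A" using subset_cent_commute[of A "{d}"] A_subset c by simp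
  then show ?thesis using D_Int_cent_A[OF h] d by blast
qed

text \<open>\<open>D h\<close> behaves like a Frobenius complement of \<open>A\<close> in
  \<open>M\<close>. If \<open>x\<close> is the conjugate of \<open>d\<close> by \<open>a\<close>,
  then \<open>inv d \<otimes> x\<close> lies in \<open>A\<close> because \<open>d\<close> normalises
  \<open>A\<close>. If \<open>x\<close> and \<open>d\<close> are both in \<open>D h\<close>, this
  quotient is trivial and \<open>d\<close> commutes with \<open>a\<close>.\<close>

lemma D_Int_conj:
  assumes h: "h \<in> carrier G" "h \<notin> M" and a: "a \<in> A" "a \<noteq> \<one>"
  shows "D h \<inter> conj_set a (D h) = {\<one>}"
proof -
  have ac: "a \<in> carrier G" using a A_subset by auto
  have DC: "D h \<subseteq> carrier G" using M_subset by blast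
  have "x = \<one>" if x: "x \<in> D h" "x \<in> conj_set a (D h)" for x
  proof -
    obtain d where d: "d \<in> D h" "x = a \<otimes> d \<otimes> inv a" using x unfolding conj_set_def by auto
    have c: "d \<in> carrier G" "x \<in> carrier G" using d x DC by auto
    have "inv d \<otimes> x \<in> D h"
      using d(1) x(1) subgroup.m_closed[OF subgroup_D[OF h(1)]] subgroup.m_inv_closed[OF subgroup_D[OF h(1)]]
      by blast
    moreover have "inv d \<otimes> x \<in> A"
    proof -
      have "inv d \<in> nrm A" using d nrm_A subgroup.m_inv_closed[OF M(1)] by auto
      then have "inv d \<otimes> a \<otimes> inv (inv d) \<in> A" using conj_setI[OF a(1), of "inv d"] by (simp add: nrm_def)
      then have "inv d \<otimes> a \<otimes> d \<otimes> inv a \<in> A"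
        using a c subgroup.m_closed[OF A(1)] subgroup.m_inv_closed[OF A(1)] by simp
      then show ?thesis using d c ac by (simp add: mult_normalize)
    qed
    ultimately have "inv d \<otimes> x = \<one>" using A_Int_conj_M[OF h] by blast
    then have "x = d" using c by (metis inv_mult_cancel(2) r_one inv_closed)
    then have "d \<otimes> a = a \<otimes> d \<otimes> inv a \<otimes> a" using d by simp
    then have "d \<otimes> a = a \<otimes> d" using c ac by (simp add: m_assoc)
    then show ?thesis using commuting_trivial[OF h a d(1)] \<open>x = d\<close> by simp
  qed
  moreover have "\<one> \<in> D h" using subgroup.one_closed[OF subgroup_D[OF h(1)]] .
  moreover have "\<one> \<in> conj_set a (D h)"
    using subgroup.one_closed[OF subgroup_conj_set[OF ac subgroup_D[OF h(1)]]] .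
  ultimately show ?thesis by blast
qed

text \<open>Conjugation by \<open>a\<close> fixes \<open>M\<close> as a set, so the Frobenius
  property makes \<open>F\<close> meet \<open>M\<close> trivially. Modularity of \<open>M\<close>
  then leaves no room for a proper nontrivial subgroup of \<open>F\<close>.\<close>

lemma exists_prime_D:
  obtains k where "k \<in> carrier G" "k \<notin> M" "prime (card (D k))"
proof -
  obtain h where h: "h \<in> carrier G" "h \<notin> M" using M M_subset by blast
  obtain a where a: "a \<in> A" "a \<noteq> \<one>" using A subgroup.one_closed[OF A(1)] by blast
  have ac: "a \<in> carrier G" using a A_subset by auto
  define M2 where "M2 = conj_set h M"
  define F where "F = M2 \<inter> conj_set a M2"
  have M2: "subgroup M2 G" "M2 \<subseteq> carrier G" unfolding M2_def
    using subgroup_conj_set[OF h(1) M(1)] subgroup.subset by auto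
  have aM2: "conj_set a M2 = conj_set (a \<otimes> h) M" using ac h M_subset by (simp add: M2_def conj_set_mult)
  have F: "subgroup F G" unfolding F_def using M2 subgroup_conj_set[OF ac M2(1)] subgroups_Inter_pair by blast
  have "conj_set a M = M" using conj_set_self[OF M(1)] a A(2) by blast
  then have "conj_set a (D h) = M \<inter> conj_set a M2" using ac M_subset M2 by (simp add: conj_set_Int M2_def)
  then have MF: "M \<inter> F = {\<one>}" using D_Int_conj[OF h a] by (auto simp: F_def M2_def)
  \<comment> \<open>If \<open>F\<close> were trivial, modularity for the conjugate of
    \<open>M2\<close> by \<open>a\<close> would give \<open>M2\<close> prime order, which
    \<open>prime_card_M_False\<close> excludes.\<close>
  have F1: "F \<noteq> {\<one>}"
  proof
    assume F1: "F = {\<one>}"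
    have "prime (card M2)"
    proof (rule prime_card_if_minimal[OF M2(1)])
      have "D h \<subseteq> M2" by (auto simp: M2_def)
      then show "M2 \<noteq> {\<one>}" using D_nontrivial[OF h] subgroup.one_closed[OF subgroup_D[OF h(1)]] by blast
    next
      fix R assume R: "subgroup R G" "R \<subseteq> M2"
      have "conj_set (a \<otimes> h) M \<inter> M2 \<subseteq> R"
        using F1 aM2 subgroup.one_closed[OF R(1)] unfolding F_def by (simp add: Int_commute)
      then have "R \<subseteq> conj_set a M2 \<or> R = M2" using modular_conj[OF _ M2(1) R(1)] R(2) ac h aM2 by simp
      then show "R = {\<one>} \<or> R = M2" using F1 R subgroup.one_closed[OF R(1)] unfolding F_def by blast
    qed
    then show False using prime_card_M_False card_conj_set[OF h(1) M_subset] by (simp add: M2_def)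
  qed
  have pF: "prime (card F)"
  proof (rule prime_card_if_minimal[OF F F1])
    fix R assume R: "subgroup R G" "R \<subseteq> F"
    then have "R \<subseteq> M \<or> R = F" using modular[OF F R(1)] MF subgroup.one_closed[OF R(1)] by simp
    then show "R = {\<one>} \<or> R = F" using R(2) MF subgroup.one_closed[OF R(1)] by blast
  qed
  \<comment> \<open>Conjugation by \<open>inv h\<close> carries \<open>M2\<close> to
    \<open>M\<close>, and the conjugate of \<open>M2\<close> by \<open>a\<close> to that of
    \<open>M\<close> by this \<open>k\<close>.\<close>
  define k where "k = inv h \<otimes> a \<otimes> h"
  have k: "k \<in> carrier G" using ac h by (simp add: k_def)
  have "a \<notin> M2" using A_Int_conj_M[OF h] a by (auto simp: M2_def)
  then have "k \<notin> M" using ac h M_subset by (simp add: k_def M2_def mem_conj_set_iff)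
  moreover have "conj_set (inv h) F = D k"
    using ac h M_subset M2 k
    by (simp add: F_def conj_set_Int conj_set_subset) (simp add: M2_def k_def conj_set_mult m_assoc)
  then have "card (D k) = card F" using card_conj_set[of "inv h" F] h subgroup.subset[OF F] by simp
  ultimately show ?thesis using that[OF k] pF by simp
qed

text \<open>With \<open>e = a \<otimes> d\<close>, the task is to write \<open>a\<close> as a
  commutator of some \<open>b\<close> in \<open>A\<close> with \<open>d\<close>. Since
  \<open>d\<close> commutes with no nontrivial element of \<open>A\<close>, the commutator map is
  injective on the finite group \<open>A\<close>, hence surjective.\<close>

lemma mem_conj_D:
  assumes h: "h \<in> carrier G" "h \<notin> M" and e: "e \<in> M" "e \<notin> A"
  obtains a where "a \<in> A" "e \<in> conj_set a (D h)"
proof -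
  obtain a d where ad: "a \<in> A" "d \<in> D h" "e = a \<otimes> d" using M_factorize[OF h e(1)] by blast
  have c: "a \<in> carrier G" "d \<in> carrier G" using ad A_subset M_subset by auto
  have d1: "d \<noteq> \<one>" using ad e c by auto
  define f where "f b = b \<otimes> (d \<otimes> inv b \<otimes> inv d)" for b
  have "f ` A \<subseteq> A"
  proof
    fix y assume "y \<in> f ` A"
    then obtain b where b: "b \<in> A" "y = f b" by blast
    have "inv b \<in> A" using b subgroup.m_inv_closed[OF A(1)] by blast
    moreover have "d \<in> nrm A" using ad nrm_A by blast
    ultimately have "d \<otimes> inv b \<otimes> inv d \<in> A" using conj_setI[of "inv b" A d] by (simp add: nrm_def)
    then show "y \<in> A" using b subgroup.m_closed[OF A(1)] by (simp add: f_def)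
  qed
  moreover have "inj_on f A"
  proof (rule inj_onI, rule ccontr)
    fix b b' assume b: "b \<in> A" "b' \<in> A" "f b = f b'" "b \<noteq> b'"
    have bc: "b \<in> carrier G" "b' \<in> carrier G" using b A_subset by auto
    define z where "z = inv b' \<otimes> b"
    have z: "z \<in> A" "z \<noteq> \<one>"
      using b bc subgroup.m_closed[OF A(1)] subgroup.m_inv_closed[OF A(1)] unfolding z_def
      by (auto simp: inv_solve_left')
    have "d \<otimes> z = inv b' \<otimes> f b' \<otimes> d \<otimes> b" using bc c by (simp add: f_def z_def mult_normalize)
    also have "\<dots> = inv b' \<otimes> f b \<otimes> d \<otimes> b" using b by simp
    also have "\<dots> = z \<otimes> d" using bc c by (simp add: f_def z_def mult_normalize)
    finally show False using commuting_trivial[OF h z ad(2)] d1 by blast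
  qed
  ultimately have "f ` A = A" using endo_inj_surj[of A f] finite_subgroup[OF A(1)] by blast
  then have "a \<in> f ` A" using ad(1) by simp
  then obtain b where b: "b \<in> A" "f b = a" by blast
  have bc: "b \<in> carrier G" using b A_subset by auto
  have "e = f b \<otimes> d" using ad b by simp
  also have "\<dots> = b \<otimes> d \<otimes> inv b" using bc c by (simp add: f_def mult_normalize)
  finally have "e \<in> conj_set b (D h)" using conj_setI[OF ad(2)] by simp
  then show ?thesis using that b by blast
qed

text \<open>A conjugate of \<open>M\<close> that omits \<open>E\<close> meets the normaliser
  \<open>N\<close> of \<open>E\<close> in a nontrivial element, which leads to a second conjugate
  \<open>F\<close> of \<open>E\<close> with \<open>N = F E\<close>. Then \<open>E\<close> and
  \<open>F\<close> have the same normaliser; as \<open>N\<close> is self-normalising, this forces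
  \<open>F = E\<close>.\<close>

lemma contradiction: False
proof -
  obtain g where g: "g \<in> carrier G" "g \<notin> M" and p: "prime (card (D g))" by (rule exists_prime_D)
  define E where "E = D g"
  have E: "subgroup E G" "E \<subseteq> M" "E \<subseteq> carrier G" "prime (card E)"
    using p subgroup_D[OF g(1)] M_subset by (auto simp: E_def)
  have E1: "E \<noteq> {\<one>}" using prime_card_ne_one E by blast
  define N where "N = nrm E"
  have N: "subgroup N G" "E \<subseteq> N" "N \<subseteq> carrier G"
    unfolding N_def
    using subgroup_nrm[OF E(3)] subset_nrm[OF E(1)] subgroup.subset[OF subgroup_nrm[OF E(3)]] .
  \<comment> \<open>The factor \<open>a\<close> of \<open>x\<close> normalises \<open>E\<close>, so
    it is trivial by \<open>D_Int_conj\<close>.\<close>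
  have E_le_nrm: "x \<in> E" if x: "x \<in> M" "x \<in> N" for x
  proof -
    obtain a d where ad: "a \<in> A" "d \<in> E" "x = a \<otimes> d" using M_factorize[OF g x(1)] by (auto simp: E_def)
    have c: "a \<in> carrier G" "d \<in> carrier G" using ad A_subset E by auto
    have "a = x \<otimes> inv d" using ad c by (simp add: m_assoc)
    moreover have "inv d \<in> N" using ad N(2) subgroup.m_inv_closed[OF N(1)] by blast
    ultimately have "a \<in> N" using x subgroup.m_closed[OF N(1)] by simp
    then have "conj_set a E = E" by (simp add: N_def nrm_def)
    then have "a = \<one>" using D_Int_conj[OF g ad(1)] E1 by (auto simp: E_def)
    then show ?thesis using ad c by simp
  qed
  then have MN: "M \<inter> N = E" using E N by blast
  have conj_E: "conj_set (k \<otimes> a) E \<subseteq> carrier G" "subgroup (conj_set (k \<otimes> a) E) G"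
    "card (conj_set (k \<otimes> a) E) = card E" "conj_set (k \<otimes> a) E \<subseteq> conj_set k M"
    if "k \<in> carrier G" "a \<in> A" for k a
  proof -
    have a: "a \<in> carrier G" "a \<in> M" using that A(2) A_subset by auto
    then show "conj_set (k \<otimes> a) E \<subseteq> carrier G" "subgroup (conj_set (k \<otimes> a) E) G"
      "card (conj_set (k \<otimes> a) E) = card E"
      using that E by (simp_all add: conj_set_subset subgroup_conj_set card_conj_set)
    have "conj_set a E \<subseteq> M" using conj_set_mono[OF E(2)] conj_set_self[OF M(1) a(2)] by blast
    then show "conj_set (k \<otimes> a) E \<subseteq> conj_set k M"
      using conj_set_mono[of "conj_set a E" M k] that a E by (simp add: conj_set_mult)
  qed
  \<comment> \<open>This transports \<open>mem_conj_D\<close> to the conjugates of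
    \<open>M\<close>.\<close>
  have mem_cases: "x \<in> conj_set k A \<or> (\<exists>a\<in>A. x \<in> conj_set (k \<otimes> a) E)"
    if k: "k \<in> carrier G" and x: "x \<in> conj_set k M" for k x
  proof -
    obtain y where y: "y \<in> M" "x = k \<otimes> y \<otimes> inv k" using x by (auto simp: conj_set_def)
    show ?thesis
    proof (cases "y \<in> A")
      case True
      then show ?thesis using y conj_setI by blast
    next
      case False
      then obtain a where a: "a \<in> A" "y \<in> conj_set a E" using mem_conj_D[OF g y(1)] by (auto simp: E_def)
      have "x \<in> conj_set k (conj_set a E)" using a y conj_setI by blast
      then have "x \<in> conj_set (k \<otimes> a) E" using a k A_subset E by (simp add: conj_set_mult subset_iff)
      then show ?thesis using a by blast
    qed
  qed
  \<comment> \<open>A nontrivial \<open>d\<close> in \<open>E\<close> lies in the conjugate of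
    \<open>M\<close> by \<open>g\<close>, but not in that of \<open>A\<close>, so it lies in the
    conjugate of \<open>E\<close> by some \<open>g \<otimes> a\<close>. This conjugate is
    \<open>E\<close> itself, and \<open>g \<otimes> a\<close> is in \<open>N\<close> but not in
    \<open>M\<close>.\<close>
  have "\<not> N \<subseteq> M"
  proof -
    obtain d where d: "d \<in> E" "d \<noteq> \<one>" using E1 subgroup.one_closed[OF E(1)] by blast
    have dM: "d \<in> M" "d \<in> conj_set g M" using d by (auto simp: E_def)
    have "d \<notin> conj_set g A"
    proof
      assume "d \<in> conj_set g A"
      then have "inv g \<otimes> d \<otimes> g \<in> A" using g A_subset by (simp add: mem_conj_set_iff)
      moreover have "inv g \<otimes> d \<otimes> g \<in> conj_set (inv g) M" using conj_setI[OF dM(1), of "inv g"] g by simp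
      moreover have "inv g \<notin> M" using g subgroup.m_inv_closed[OF M(1), of "inv g"] by auto
      ultimately have "inv g \<otimes> d \<otimes> g = \<one>" using A_Int_conj_M[of "inv g"] g by blast
      then have "g \<otimes> (inv g \<otimes> d \<otimes> g) \<otimes> inv g = g \<otimes> \<one> \<otimes> inv g" by simp
      then show False using g d dM M_subset by (auto simp: mult_normalize subset_iff)
    qed
    then obtain a where a: "a \<in> A" "d \<in> conj_set (g \<otimes> a) E" using mem_cases[OF g(1) dM(2)] by blast
    have ac: "a \<in> carrier G" "a \<in> M" using a A(2) A_subset by auto
    note conj = conj_E[OF g(1) a(1)]
    have "conj_set (g \<otimes> a) E \<subseteq> E"
      using conj a E d by (intro prime_card_eq[of _ _ d]) auto
    then have "g \<otimes> a \<in> N" unfolding N_def using g ac E by (intro nrmI) auto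
    moreover have "g \<otimes> a \<notin> M"
    proof
      assume "g \<otimes> a \<in> M"
      then have "g \<otimes> a \<otimes> inv a \<in> M" using ac subgroup.m_closed[OF M(1)] subgroup.m_inv_closed[OF M(1)] by blast
      then show False using g ac by (simp add: m_assoc)
    qed
    ultimately show ?thesis by blast
  qed
  then have NE: "N \<noteq> E" using E by blast
  have N_max: "W = N" if "subgroup W G" "E \<subseteq> W" "W \<subseteq> N" "\<not> W \<subseteq> M" for W
    using modular[OF N(1) that(1)] MN that by blast
  \<comment> \<open>If \<open>E\<close> were larger than \<open>A\<close>, normalising
    \<open>A\<close> would mean centralising it, against faithfulness.\<close>
  have le: "card E \<le> card A"
  proof (rule ccontr)
    assume "\<not> card E \<le> card A"
    then have "E \<subseteq> cent A" using E A(1) prime_card_A nrm_A by (intro prime_card_centralizes) auto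
    then show False using D_Int_cent_A[OF g] E1 subgroup.one_closed[OF E(1)] by (auto simp: E_def)
  qed
  obtain k where k: "k \<in> carrier G" "\<not> E \<subseteq> conj_set k M"
    using not_subset_all_conj[of E] E1 subgroup.one_closed[OF E(1)] by blast
  have "N \<inter> conj_set k M \<noteq> {\<one>}"
  proof
    assume "N \<inter> conj_set k M = {\<one>}"
    then have "conj_set k M \<inter> N \<subseteq> E" using subgroup.one_closed[OF E(1)] by (simp add: Int_commute)
    then show False using modular_conj[OF k(1) N(1) E(1)] N(2) k(2) NE by blast
  qed
  moreover have "\<one> \<in> N" "\<one> \<in> conj_set k M"
    using subgroup.one_closed[OF N(1)] subgroup.one_closed[OF subgroup_conj_set[OF k(1) M(1)]] .
  ultimately obtain x where x: "x \<in> N" "x \<in> conj_set k M" "x \<noteq> \<one>" by blast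
  \<comment> \<open>Otherwise the conjugate of \<open>A\<close> normalises \<open>E\<close> and, by
    \<open>le\<close>, centralises it. Then \<open>E\<close> lies in its normaliser, the conjugate
    of \<open>M\<close> by \<open>k\<close>.\<close>
  have "x \<notin> conj_set k A"
  proof
    assume xA: "x \<in> conj_set k A"
    note kA = conj_A[OF k(1)]
    have "conj_set k A \<subseteq> N"
      using kA prime_card_A x xA N by (intro prime_card_eq[of _ _ x]) auto
    then have "conj_set k A \<subseteq> cent E"
      using kA E le prime_card_A by (intro prime_card_centralizes) (auto simp: N_def)
    then have "E \<subseteq> cent (conj_set k A)" using subset_cent_commute kA E by blast
    then have "E \<subseteq> nrm (conj_set k A)" using cent_subset_nrm kA by blast
    then show False using kA k by simp
  qed
  then obtain a where a: "a \<in> A" "x \<in> conj_set (k \<otimes> a) E" using mem_cases[OF k(1) x(2)] by blast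
  define t where "t = k \<otimes> a"
  define F where "F = conj_set t E"
  have t: "t \<in> carrier G" using k a A_subset by (auto simp: t_def)
  have F: "F \<subseteq> carrier G" "subgroup F G" "card F = card E" "F \<subseteq> conj_set k M"
    unfolding F_def t_def using conj_E[OF k(1) a(1)] .
  have FE: "F \<noteq> E" using F k by blast
  have FN: "F \<subseteq> N" using F E x a N by (intro prime_card_eq[of _ _ x]) (auto simp: F_def t_def)
  then have "F \<subseteq> cent E" using F E by (intro prime_card_centralizes) (auto simp: N_def)
  then have "E \<subseteq> cent F" using subset_cent_commute F E by blast
  then have EF: "E \<subseteq> nrm F" using cent_subset_nrm F by blast
  have "\<not> F \<subseteq> M"
  proof
    assume "F \<subseteq> M"
    then have "F \<subseteq> E" using MN FN by blast
    then show False using FE F(3) card_subset_eq finite_subgroup[OF E(1)] by blast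
  qed
  \<comment> \<open>Both factors normalise \<open>F\<close>, so \<open>N\<close> lies in
    \<open>nrm F\<close>, which is the conjugate of \<open>N\<close> by \<open>t\<close>.\<close>
  then have "F <#> E = N"
    using subset_set_mult[OF F(2) E(1)] EF F E N FN
    by (intro N_max subgroup_set_mult_nrm set_mult_subset) auto
  then have "N \<subseteq> nrm F"
    using EF subset_nrm[OF F(2)] set_mult_subset[OF subgroup_nrm[OF F(1)]] by blast
  then have "N \<subseteq> conj_set t N" unfolding F_def N_def using nrm_conj_set[OF t E(3)] by simp
  then have "conj_set t N = N"
    using card_conj_set[OF t N(3)] card_subset_eq[of "conj_set t N" N]
      finite_subgroup[OF subgroup_conj_set[OF t N(1)]] by simp
  then have tT: "t \<in> nrm N" using t by (simp add: nrm_def)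
  \<comment> \<open>Elements of \<open>M\<close> that normalise \<open>N\<close> also normalise
    \<open>M \<inter> N = E\<close>. Modularity then makes \<open>N\<close>
    self-normalising.\<close>
  have "M \<inter> nrm N \<subseteq> N"
    using nrm_Int[OF M_subset N(3)] subset_nrm[OF M(1)] MN by (auto simp: N_def)
  then have "N = nrm N"
    using modular[OF subgroup_nrm[OF N(3)] N(1)] subset_nrm[OF N(1)] \<open>\<not> N \<subseteq> M\<close> by blast
  then have "F = E" using tT by (simp add: F_def N_def nrm_def)
  then show False using FE by blast
qed

end

lemma (in group) nrm_derived:
  assumes "H \<subseteq> carrier G" "g \<in> nrm H"
  shows "g \<in> nrm (derived G H)"
proof -
  have g: "g \<in> carrier G" "conj_set g H = H" using assms by (auto simp: nrm_def)
  interpret conj: group_hom G G "\<lambda>x. g \<otimes> x \<otimes> inv g"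
    by unfold_locales (auto simp: hom_def g mult_normalize)
  show ?thesis using conj.derived_img[OF assms(1)] g by (simp add: nrm_def conj_set_def)
qed

lemma (in group) derived_trivial_imp_commute:
  assumes H: "subgroup H G" and "derived G H = {\<one>}"
  shows "H \<subseteq> cent H"
proof
  fix x assume x: "x \<in> H"
  have "x \<otimes> y = y \<otimes> x" if y: "y \<in> H" for y
  proof -
    have c: "x \<in> carrier G" "y \<in> carrier G" using x y subgroup.subset[OF H] by auto
    have "x \<otimes> y \<otimes> inv x \<otimes> inv y \<in> derived_set G H" using x y by blast
    then have "x \<otimes> y \<otimes> inv x \<otimes> inv y \<in> derived G H" unfolding derived_def by (rule generate.incl)
    then have "x \<otimes> y \<otimes> inv x \<otimes> inv y = \<one>" using assms(2) by simp
    then have "x \<otimes> y \<otimes> inv x \<otimes> inv y \<otimes> (y \<otimes> x) = \<one> \<otimes> (y \<otimes> x)" by simp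
    then show ?thesis using c by (simp add: mult_normalize)
  qed
  with x show "x \<in> cent H" using subgroup.subset[OF H] unfolding cent_def by blast
qed

text \<open>The last nontrivial term of the derived series of \<open>M\<close> is abelian and
  normalised by \<open>M\<close>. A subgroup of least order with these properties serves as
  \<open>A\<close>; commutativity passes to its subgroups, which gives minimality.\<close>

lemma (in simple_group_modular_coatom) solvable_imp_trivial:
  assumes "solvable_seq G M"
  shows "M = {\<one>}"
proof (rule ccontr)
  assume ne: "M \<noteq> {\<one>}"
  define P where "P B \<longleftrightarrow> subgroup B G \<and> B \<subseteq> M \<and> B \<noteq> {\<one>} \<and> M \<subseteq> nrm B \<and> B \<subseteq> cent B" for B
  let ?D = "\<lambda>n. (derived G ^^ n) M"
  have sub: "subgroup (?D n) G" for n by (rule exp_of_derived_is_subgroup[OF M(1)])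
  have step: "?D n \<subseteq> M \<and> M \<subseteq> nrm (?D n)" for n
  proof (induction n)
    case 0
    then show ?case using subset_nrm[OF M(1)] by simp
  next
    case (Suc n)
    have "derived G (?D n) \<subseteq> ?D n" using derived_incl[OF _ sub[of n], of "?D n"] by simp
    moreover have "M \<subseteq> nrm (derived G (?D n))"
      using Suc nrm_derived[OF subgroup.subset[OF sub[of n]]] by blast
    ultimately show ?case using Suc by auto
  qed
  have ex: "\<exists>n. ?D n = {\<one>}" using assms by (rule solvable_imp_trivial_derived_seq)
  define n where "n = (LEAST n. ?D n = {\<one>})"
  have n: "?D n = {\<one>}" unfolding n_def using ex by (rule LeastI_ex)
  then obtain k where k: "n = Suc k" using ne by (cases n) auto
  have k1: "?D k \<noteq> {\<one>}" using not_less_Least[of k "\<lambda>n. ?D n = {\<one>}"] k by (simp add: n_def)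
  have "derived G (?D k) = {\<one>}" using n k by simp
  then have "?D k \<subseteq> cent (?D k)" by (rule derived_trivial_imp_commute[OF sub])
  then have "P (?D k)" unfolding P_def using sub step k1 by blast
  then obtain A where A: "P A" and least: "\<And>B. P B \<Longrightarrow> card A \<le> card B"
    using ex_has_least_nat[of P _ card] by blast
  have minimal: "B = A" if B: "subgroup B G" "B \<subseteq> A" "B \<noteq> {\<one>}" "M \<subseteq> nrm B" for B
  proof -
    have "B \<subseteq> cent B" using A B(2) unfolding P_def cent_def by blast
    then have "P B" using A B unfolding P_def by blast
    then have "card A \<le> card B" by (rule least)
    moreover have "finite A" using A finite_subgroup unfolding P_def by blast
    ultimately show "B = A" using B(2) card_seteq by blast
  qed
  interpret simple_group_modular_coatom_abelian G M A
    using A minimal simple_group_modular_coatom_axioms unfolding P_def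
    by (intro simple_group_modular_coatom_abelian.intro simple_group_modular_coatom_abelian_axioms.intro)
      simp_all
  show False by (rule contradiction)
qed

subsection \<open>Intervals of the subgroup lattice\<close>

text \<open>A join-free form of both properties: \<open>X = v\<close> expresses maximality, and for
  \<open>W\<close> not below \<open>m\<close> the modular law amounts to
  \<open>W = X\<close>.\<close>

definition modular_coatom :: "('a, 'b) monoid_scheme \<Rightarrow> 'a set \<Rightarrow> 'a set \<Rightarrow> 'a set \<Rightarrow> bool" where
  "modular_coatom G u v m \<longleftrightarrow> subgroup m G \<and> u \<subseteq> m \<and> m \<subset> v \<and>
     (\<forall>X W. subgroup X G \<longrightarrow> subgroup W G \<longrightarrow> u \<subseteq> W \<longrightarrow> m \<inter> X \<subseteq> W \<longrightarrow> W \<subseteq> X \<longrightarrow> X \<subseteq> v \<longrightarrow>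
        W \<subseteq> m \<or> W = X)"

lemma modular_coatomD:
  assumes "modular_coatom G u v m"
  shows "subgroup m G" "u \<subseteq> m" "m \<subset> v"
    "subgroup X G \<Longrightarrow> subgroup W G \<Longrightarrow> u \<subseteq> W \<Longrightarrow> m \<inter> X \<subseteq> W \<Longrightarrow> W \<subseteq> X \<Longrightarrow> X \<subseteq> v \<Longrightarrow> W \<subseteq> m \<or> W = X"
  using assms unfolding modular_coatom_def by blast+

context group
begin

lemma carrier_interval_subgroup_lattice:
  "carrier (interval (subgroup_lattice G) u v) = {H. subgroup H G \<and> u \<subseteq> H \<and> H \<subseteq> v}"
  by (auto simp: interval_def subgroup_lattice_def at_least_at_most_def)

lemma interval_subgroup_lattice_order [simp]:
  "x \<sqsubseteq>\<^bsub>interval (subgroup_lattice G) u v\<^esub> y \<longleftrightarrow> x \<subseteq> y"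
  "x \<sqsubset>\<^bsub>interval (subgroup_lattice G) u v\<^esub> y \<longleftrightarrow> x \<subset> y"
  "x .=\<^bsub>interval (subgroup_lattice G) u v\<^esub> y \<longleftrightarrow> x = y"
  by (auto simp: interval_def subgroup_lattice_def lless_def)

text \<open>The supremum is a Hilbert choice among least upper bounds, so the given one must be
  shown to be unique.\<close>

lemma interval_subgroup_lattice_lub:
  assumes "least (interval (subgroup_lattice G) u v) s (Upper (interval (subgroup_lattice G) u v) A)"
  shows "\<Squnion>\<^bsub>interval (subgroup_lattice G) u v\<^esub>A = s"
  unfolding sup_def
proof (rule some_equality[where P = "\<lambda>x. least (interval (subgroup_lattice G) u v) x
      (Upper (interval (subgroup_lattice G) u v) A)", OF assms])
  fix x assume "least (interval (subgroup_lattice G) u v) x (Upper (interval (subgroup_lattice G) u v) A)"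
  with assms show "x = s" by (auto simp: least_def)
qed

lemma interval_subgroup_lattice_glb:
  assumes "greatest (interval (subgroup_lattice G) u v) s (Lower (interval (subgroup_lattice G) u v) A)"
  shows "\<Sqinter>\<^bsub>interval (subgroup_lattice G) u v\<^esub>A = s"
  unfolding inf_def
proof (rule some_equality[where P = "\<lambda>x. greatest (interval (subgroup_lattice G) u v) x
      (Lower (interval (subgroup_lattice G) u v) A)", OF assms])
  fix x assume "greatest (interval (subgroup_lattice G) u v) x (Lower (interval (subgroup_lattice G) u v) A)"
  with assms show "x = s" by (auto simp: greatest_def)
qed

lemma interval_subgroup_lattice_join:
  assumes "subgroup v G" "subgroup H G" "subgroup K G" "u \<subseteq> H" "H \<subseteq> v" "u \<subseteq> K" "K \<subseteq> v"
  shows "H \<squnion>\<^bsub>interval (subgroup_lattice G) u v\<^esub> K = generate G (H \<union> K)"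
  unfolding join_def
proof (rule interval_subgroup_lattice_lub)
  have "H \<union> K \<subseteq> carrier G" using subgroup.subset assms(2,3) by blast
  then have "subgroup (generate G (H \<union> K)) G" by (rule generate_is_subgroup)
  moreover have "H \<union> K \<subseteq> generate G (H \<union> K)" by (auto intro: generate.incl)
  moreover have "generate G (H \<union> K) \<subseteq> L" if "subgroup L G" "H \<subseteq> L" "K \<subseteq> L" for L
    using that by (intro generate_subgroup_incl) auto
  ultimately show "least (interval (subgroup_lattice G) u v) (generate G (H \<union> K))
      (Upper (interval (subgroup_lattice G) u v) {H, K})"
    using assms by (auto simp: least_def Upper_def carrier_interval_subgroup_lattice)
qed

lemma interval_subgroup_lattice_meet:
  assumes "subgroup H G" "subgroup K G" "u \<subseteq> H" "H \<subseteq> v" "u \<subseteq> K" "K \<subseteq> v"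
  shows "H \<sqinter>\<^bsub>interval (subgroup_lattice G) u v\<^esub> K = H \<inter> K"
  unfolding meet_def
proof (rule interval_subgroup_lattice_glb)
  have "subgroup (H \<inter> K) G" using assms(1,2) by (rule subgroups_Inter_pair)
  then show "greatest (interval (subgroup_lattice G) u v) (H \<inter> K)
      (Lower (interval (subgroup_lattice G) u v) {H, K})"
    using assms by (auto simp: greatest_def Lower_def carrier_interval_subgroup_lattice)
qed

lemma interval_subgroup_lattice_top:
  assumes "subgroup v G" "u \<subseteq> v"
  shows "\<top>\<^bsub>interval (subgroup_lattice G) u v\<^esub> = v"
proof -
  have "greatest (interval (subgroup_lattice G) u v) v (carrier (interval (subgroup_lattice G) u v))"
    using assms by (auto simp: greatest_def carrier_interval_subgroup_lattice)
  then show ?thesis unfolding top_def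
  proof (rule some_equality)
    fix x assume "greatest (interval (subgroup_lattice G) u v) x (carrier (interval (subgroup_lattice G) u v))"
    then show "x = v"
      using assms by (auto simp: greatest_def carrier_interval_subgroup_lattice)
  qed
qed

text \<open>If \<open>x\<close> lies below \<open>m\<close>, both sides of the modular law equal
  \<open>m \<inter> y\<close>. Otherwise \<open>x\<close> and \<open>m\<close> generate
  \<open>v\<close>, and the law says that \<open>x\<close> and \<open>m \<inter> y\<close> generate
  \<open>y\<close>.\<close>

lemma modular_coatom_iff:
  assumes v: "subgroup v G" and uv: "u \<subseteq> v"
  shows "coatom (interval (subgroup_lattice G) u v) m \<and> left_modular (interval (subgroup_lattice G) u v) m
    \<longleftrightarrow> modular_coatom G u v m"
proof -
  let ?L = "interval (subgroup_lattice G) u v"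
  note carr = carrier_interval_subgroup_lattice and top = interval_subgroup_lattice_top[OF v uv]
  have coatom: "coatom ?L m \<longleftrightarrow> subgroup m G \<and> u \<subseteq> m \<and> m \<subset> v \<and>
      (\<forall>x. subgroup x G \<longrightarrow> m \<subset> x \<longrightarrow> x \<subseteq> v \<longrightarrow> x = v)"
    unfolding coatom_def carr top using uv by (simp add: psubset_eq) blast
  have gen: "subgroup (generate G (H \<union> K)) G" "H \<subseteq> generate G (H \<union> K)" "K \<subseteq> generate G (H \<union> K)"
    "\<And>L. subgroup L G \<Longrightarrow> H \<subseteq> L \<Longrightarrow> K \<subseteq> L \<Longrightarrow> generate G (H \<union> K) \<subseteq> L"
    if "subgroup H G" "subgroup K G" for H K
    using that subgroup.subset[OF that(1)] subgroup.subset[OF that(2)] generate_is_subgroup[of "H \<union> K"]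
      generate_subgroup_incl[of "H \<union> K"]
    by (auto intro: generate.incl)
  have lm: "left_modular ?L m \<longleftrightarrow> (\<forall>x y. subgroup x G \<longrightarrow> subgroup y G \<longrightarrow> u \<subseteq> x \<longrightarrow> x \<subset> y \<longrightarrow> y \<subseteq> v \<longrightarrow>
      generate G (x \<union> m) \<inter> y = generate G (x \<union> (m \<inter> y)))"
    if m: "subgroup m G" "u \<subseteq> m" "m \<subset> v"
  proof -
    have eqs: "(x \<squnion>\<^bsub>?L\<^esub> m) \<sqinter>\<^bsub>?L\<^esub> y = generate G (x \<union> m) \<inter> y" "x \<squnion>\<^bsub>?L\<^esub> (m \<sqinter>\<^bsub>?L\<^esub> y) = generate G (x \<union> (m \<inter> y))"
      if "subgroup x G" "subgroup y G" "u \<subseteq> x" "x \<subset> y" "y \<subseteq> v" for x y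
    proof -
      have xv: "x \<subseteq> v" "m \<subseteq> v" "u \<subseteq> y" using that m by auto
      have "x \<squnion>\<^bsub>?L\<^esub> m = generate G (x \<union> m)" using v that m xv by (intro interval_subgroup_lattice_join)
      moreover have "u \<subseteq> generate G (x \<union> m)" "generate G (x \<union> m) \<subseteq> v" "subgroup (generate G (x \<union> m)) G"
        using gen[OF that(1) m(1)] that(3) xv v by blast+
      ultimately show "(x \<squnion>\<^bsub>?L\<^esub> m) \<sqinter>\<^bsub>?L\<^esub> y = generate G (x \<union> m) \<inter> y"
        using that xv by (simp add: interval_subgroup_lattice_meet)
      have "m \<sqinter>\<^bsub>?L\<^esub> y = m \<inter> y" using that m xv by (intro interval_subgroup_lattice_meet)
      moreover have "subgroup (m \<inter> y) G" using m(1) that(2) by (rule subgroups_Inter_pair)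
      ultimately show "x \<squnion>\<^bsub>?L\<^esub> (m \<sqinter>\<^bsub>?L\<^esub> y) = generate G (x \<union> (m \<inter> y))"
        using that xv m v by (simp add: interval_subgroup_lattice_join le_infI1)
    qed
    have "left_modular ?L m \<longleftrightarrow> (\<forall>x\<in>carrier ?L. \<forall>y\<in>carrier ?L. x \<subset> y \<longrightarrow>
        (x \<squnion>\<^bsub>?L\<^esub> m) \<sqinter>\<^bsub>?L\<^esub> y = x \<squnion>\<^bsub>?L\<^esub> (m \<sqinter>\<^bsub>?L\<^esub> y))"
      using m unfolding left_modular_def by (simp add: carr psubset_imp_subset)
    also have "\<dots> \<longleftrightarrow> (\<forall>x y. subgroup x G \<longrightarrow> subgroup y G \<longrightarrow> u \<subseteq> x \<longrightarrow> x \<subset> y \<longrightarrow> y \<subseteq> v \<longrightarrow>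
        (x \<squnion>\<^bsub>?L\<^esub> m) \<sqinter>\<^bsub>?L\<^esub> y = x \<squnion>\<^bsub>?L\<^esub> (m \<sqinter>\<^bsub>?L\<^esub> y))"
      unfolding carr by blast
    also have "\<dots> \<longleftrightarrow> (\<forall>x y. subgroup x G \<longrightarrow> subgroup y G \<longrightarrow> u \<subseteq> x \<longrightarrow> x \<subset> y \<longrightarrow> y \<subseteq> v \<longrightarrow>
        generate G (x \<union> m) \<inter> y = generate G (x \<union> (m \<inter> y)))"
      by (simp add: eqs cong: imp_cong)
    finally show ?thesis .
  qed
  show ?thesis
  proof
    assume L: "coatom ?L m \<and> left_modular ?L m"
    then have m: "subgroup m G" "u \<subseteq> m" "m \<subset> v"
      and max: "\<And>x. subgroup x G \<Longrightarrow> m \<subset> x \<Longrightarrow> x \<subseteq> v \<Longrightarrow> x = v" by (auto simp: coatom)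
    have "W \<subseteq> m \<or> W = X" if W: "subgroup X G" "subgroup W G" "u \<subseteq> W" "m \<inter> X \<subseteq> W" "W \<subseteq> X" "X \<subseteq> v" for X W
    proof (rule ccontr)
      assume contra: "\<not> ?thesis"
      then have "generate G (W \<union> m) \<inter> X = generate G (W \<union> (m \<inter> X))"
        using L lm[OF m] W by blast
      moreover have "generate G (W \<union> m) = v"
        using gen[OF W(2) m(1)] contra W m v by (intro max) blast+
      moreover have "generate G (W \<union> (m \<inter> X)) \<subseteq> W"
        using W by (intro generate_subgroup_incl) auto
      ultimately show False using W contra by blast
    qed
    with m show "modular_coatom G u v m" unfolding modular_coatom_def by blast
  next
    assume "modular_coatom G u v m"
    note m = modular_coatomD[OF this]
    have max: "x = v" if "subgroup x G" "m \<subset> x" "x \<subseteq> v" for x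
      using m(4)[OF v that(1)] that m(2) by blast
    have "generate G (x \<union> m) \<inter> y = generate G (x \<union> (m \<inter> y))"
      if x: "subgroup x G" "subgroup y G" "u \<subseteq> x" "x \<subset> y" "y \<subseteq> v" for x y
    proof (cases "x \<subseteq> m")
      case True
      have my: "subgroup (m \<inter> y) G" using m(1) x(2) by (rule subgroups_Inter_pair)
      have "generate G (x \<union> m) = m" using gen[OF x(1) m(1)] m(1) True by blast
      moreover have "generate G (x \<union> (m \<inter> y)) = m \<inter> y" using gen[OF x(1) my] my x True by blast
      ultimately show ?thesis by simp
    next
      case False
      have my: "subgroup (m \<inter> y) G" using m(1) x(2) by (rule subgroups_Inter_pair)
      have "generate G (x \<union> m) = v" using gen[OF x(1) m(1)] m(3) v x False by (intro max) blast+
      moreover have "generate G (x \<union> (m \<inter> y)) \<subseteq> m \<or> generate G (x \<union> (m \<inter> y)) = y"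
        using gen[OF x(1) my] x by (intro m(4)) blast+
      then have "generate G (x \<union> (m \<inter> y)) = y" using gen(2)[OF x(1) my] False by blast
      ultimately show ?thesis using x by auto
    qed
    then have "left_modular ?L m" using lm[OF m(1-3)] by blast
    moreover have "coatom ?L m" unfolding coatom using m(1-3) max by blast
    ultimately show "coatom ?L m \<and> left_modular ?L m" by blast
  qed
qed

lemma comodernistic_iff:
  "comodernistic (subgroup_lattice G) \<longleftrightarrow>
    (\<forall>u v. subgroup u G \<longrightarrow> subgroup v G \<longrightarrow> u \<subset> v \<longrightarrow> (\<exists>m. modular_coatom G u v m))"
proof -
  have "u \<sqsubset>\<^bsub>subgroup_lattice G\<^esub> v \<longleftrightarrow> u \<subset> v" "u \<in> carrier (subgroup_lattice G) \<longleftrightarrow> subgroup u G" for u v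
    by (auto simp: lless_def subgroup_lattice_def)
  then show ?thesis
    unfolding comodernistic_def Ball_def using lattice_subgroup_lattice modular_coatom_iff[OF _ psubset_imp_subset]
    by simp
qed

end

subsection \<open>Solvability and comodernism\<close>

lemma (in group) subgroup_restrict_iff:
  assumes "subgroup K G"
  shows "subgroup H (G\<lparr>carrier := K\<rparr>) \<longleftrightarrow> subgroup H G \<and> H \<subseteq> K"
proof
  assume H: "subgroup H (G\<lparr>carrier := K\<rparr>)"
  show "subgroup H G \<and> H \<subseteq> K" using incl_subgroup[OF assms H] subgroup.subset[OF H] by simp
next
  assume "subgroup H G \<and> H \<subseteq> K"
  then show "subgroup H (G\<lparr>carrier := K\<rparr>)" using subgroup_incl[of H K] assms by simp
qed

text \<open>Only subgroups of \<open>v\<close> are involved, so the interval can be studied with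
  \<open>v\<close>, or any subgroup containing it, as the ambient group.\<close>

lemma (in group) modular_coatom_restrict_iff:
  assumes K: "subgroup K G" and v: "v \<subseteq> K"
  shows "modular_coatom (G\<lparr>carrier := K\<rparr>) u v m \<longleftrightarrow> modular_coatom G u v m"
proof
  assume "modular_coatom (G\<lparr>carrier := K\<rparr>) u v m"
  note m = modular_coatomD[OF this, unfolded subgroup_restrict_iff[OF K]]
  have "W \<subseteq> m \<or> W = X"
    if "subgroup X G" "subgroup W G" "u \<subseteq> W" "m \<inter> X \<subseteq> W" "W \<subseteq> X" "X \<subseteq> v" for X W
    using that v by (intro m(4)) auto
  then show "modular_coatom G u v m" unfolding modular_coatom_def using m(1-3) by simp
next
  assume "modular_coatom G u v m"
  note m = modular_coatomD[OF this]
  show "modular_coatom (G\<lparr>carrier := K\<rparr>) u v m"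
    unfolding modular_coatom_def subgroup_restrict_iff[OF K] using m v by simp
qed

text \<open>\<open>solvable\<close> speaks of a group and \<open>solvable_seq\<close> of a subgroup
  of an ambient group; the inclusion \<open>id\<close> translates between them.\<close>

lemma (in group) solvable_restrict_imp:
  assumes K: "subgroup K G" and "solvable (G\<lparr>carrier := K\<rparr>)"
  shows "solvable_seq G K"
proof -
  interpret K: group "G\<lparr>carrier := K\<rparr>" using K by (rule subgroup_imp_group)
  interpret incl: group_hom "G\<lparr>carrier := K\<rparr>" G id
    using subgroup.subset[OF K] by unfold_locales (auto simp: hom_def)
  show ?thesis using incl.solvable_imp_solvable_img[of K] assms(2) by (simp add: solvable_def)
qed

lemma (in group) solvable_restrict:
  assumes K: "subgroup K G" and "solvable G"
  shows "solvable (G\<lparr>carrier := K\<rparr>)"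
proof -
  interpret K: group "G\<lparr>carrier := K\<rparr>" using K by (rule subgroup_imp_group)
  interpret incl: group_hom "G\<lparr>carrier := K\<rparr>" G id
    using subgroup.subset[OF K] by unfold_locales (auto simp: hom_def)
  show ?thesis
    using incl.solvable_img_imp_solvable[of K] solvable_subgroup[OF K assms(2)] K.subgroup_self
    by (simp add: solvable_def)
qed

lemma (in group) normal_nrm:
  assumes "N \<lhd> G"
  shows "nrm N = carrier G"
proof -
  have N: "subgroup N G" using assms by (rule normal_imp_subgroup)
  then have NC: "N \<subseteq> carrier G" by (rule subgroup.subset)
  have sub: "conj_set g N \<subseteq> N" if "g \<in> carrier G" for g
    using assms that by (auto simp: normal_inv_iff conj_set_def)
  have "conj_set g N = N" if g: "g \<in> carrier G" for g
    using sub[OF g] sub[of "inv g"] conj_set_subset_iff[of "inv g" N N] g NC by auto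
  then show ?thesis by (auto simp: nrm_def)
qed

section \<open>From solvability to modular coatoms\<close>

context finite_group
begin

lemma derived_psubset:
  assumes "solvable_seq G N" "N \<noteq> {\<one>}"
  shows "derived G N \<subset> N"
proof -
  have N: "subgroup N G" using assms(1) by (rule solvable_imp_subgroup)
  have "derived G N \<noteq> N"
  proof
    assume eq: "derived G N = N"
    have "(derived G ^^ n) N = N" for n by (induction n) (simp_all add: eq)
    then show False using solvable_imp_trivial_derived_seq[OF assms(1)] assms(2) by simp
  qed
  then show ?thesis using derived_incl[OF _ N, of N] by blast
qed

lemma solvable_exists_modular_coatom:
  assumes sol: "solvable G" and H: "subgroup H G" "H \<noteq> carrier G"
  shows "\<exists>m. modular_coatom G H (carrier G) m"
proof -
  have HC: "H \<subseteq> carrier G" using H(1) by (rule subgroup.subset)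
  have sub_mult: "subgroup (N <#> K) G" "N \<subseteq> N <#> K" "K \<subseteq> N <#> K"
    if "N \<lhd> G" "subgroup K G" for N K
    using that normal_nrm[OF that(1)] subset_set_mult[OF normal_imp_subgroup[OF that(1)] that(2)]
      subgroup.subset[OF that(2)] normal_imp_subgroup[OF that(1)]
    by (auto intro!: subgroup_set_mult_nrm)
  define P where "P N \<longleftrightarrow> N \<lhd> G \<and> N <#> H = carrier G" for N
  have "carrier G \<lhd> G" using subgroup_self by (auto simp: normal_inv_iff)
  then have "P (carrier G)"
    using sub_mult[of "carrier G" H] H subgroup.subset unfolding P_def by blast
  then obtain N where N: "P N" and N_least: "\<And>B. P B \<Longrightarrow> card N \<le> card B"
    using ex_has_least_nat[of P _ card] by blast
  have Nn: "N \<lhd> G" and NH: "N <#> H = carrier G" using N by (auto simp: P_def)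
  have Ns: "subgroup N G" "N \<subseteq> carrier G"
    using normal_imp_subgroup[OF Nn] subgroup.subset[OF normal_imp_subgroup[OF Nn]] .
  have "N \<noteq> {\<one>}"
  proof
    assume "N = {\<one>}"
    then have "N <#> H = H" using HC by (force simp: set_mult_def)
    then show False using NH H by simp
  qed
  \<comment> \<open>Solvability enters here: the derived subgroup is too small to satisfy
    \<open>P\<close>, which makes it a first candidate for \<open>L\<close>.\<close>
  then have der: "derived G N \<subset> N" using solvable_subgroup[OF Ns(1) sol] by (intro derived_psubset)
  define R where "R L \<longleftrightarrow> L \<lhd> G \<and> derived G N \<subseteq> L \<and> L \<subseteq> N \<and> L <#> H \<noteq> carrier G" for L
  have "\<not> P (derived G N)"
    using N_least[of "derived G N"] psubset_card_mono[OF finite_subgroup[OF Ns(1)] der] by auto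
  then have "R (derived G N)" using der derived_is_normal[OF Nn] by (auto simp: R_def P_def)
  moreover have "card L < Suc (card (carrier G))" if "R L" for L
    using that Ns card_mono[OF finite_carrier, of L] by (auto simp: R_def less_Suc_eq_le)
  ultimately obtain L where L: "R L" and L_greatest: "\<And>B. R B \<Longrightarrow> card B \<le> card L"
    using ex_has_greatest_nat[of R _ card "Suc (card (carrier G))"] by blast
  have Ln: "L \<lhd> G" "derived G N \<subseteq> L" "L \<subseteq> N" "L <#> H \<noteq> carrier G" using L by (auto simp: R_def)
  define m where "m = L <#> H"
  have m: "subgroup m G" "L \<subseteq> m" "H \<subseteq> m" unfolding m_def using sub_mult[OF Ln(1) H(1)] .
  \<comment> \<open>\<open>K\<close> is normalised by \<open>H\<close>, which lies in
    \<open>Z\<close>, and by \<open>N\<close>, whose commutators it contains; so it is normal in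
    \<open>G = N H\<close>. The choice of \<open>L\<close> gives \<open>K = L\<close>, and then each
    \<open>z = n \<otimes> h\<close> has \<open>n\<close> in \<open>L\<close>.\<close>
  have max: "Z \<subseteq> m" if Z: "subgroup Z G" "m \<subseteq> Z" "Z \<noteq> carrier G" for Z
  proof -
    define K where "K = Z \<inter> N"
    have ZC: "Z \<subseteq> carrier G" using Z(1) by (rule subgroup.subset)
    have K: "subgroup K G" "K \<subseteq> carrier G" unfolding K_def using Z(1) Ns subgroups_Inter_pair by auto
    have "Z \<subseteq> nrm K"
      using nrm_Int[OF ZC Ns(2)] subset_nrm[OF Z(1)] normal_nrm[OF Nn] ZC by (auto simp: K_def)
    then have "H \<subseteq> nrm K" using m Z by blast
    moreover have "N \<subseteq> nrm K"
    proof
      fix n assume n: "n \<in> N"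
      then have nc: "n \<in> carrier G" using Ns by blast
      have "conj_set n K \<subseteq> K"
      proof
        fix y assume "y \<in> conj_set n K"
        then obtain l where l: "l \<in> K" "y = n \<otimes> l \<otimes> inv n" by (auto simp: conj_set_def)
        have lN: "l \<in> N" "l \<in> Z" "l \<in> carrier G" using l Ns by (auto simp: K_def)
        \<comment> \<open>\<open>y\<close> is the product of this commutator and \<open>l\<close>,
          both of which lie in \<open>Z\<close>.\<close>
        have "n \<otimes> l \<otimes> inv n \<otimes> inv l \<in> derived_set G N" using n lN by blast
        then have "n \<otimes> l \<otimes> inv n \<otimes> inv l \<in> derived G N" unfolding derived_def by (rule generate.incl)
        then have "n \<otimes> l \<otimes> inv n \<otimes> inv l \<in> Z" using Ln m Z by blast
        then have "n \<otimes> l \<otimes> inv n \<otimes> inv l \<otimes> l \<in> Z" using lN subgroup.m_closed[OF Z(1)] by blast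
        then have "y \<in> Z" using l lN nc by (simp add: m_assoc)
        moreover have "y \<in> N"
          using l lN n subgroup.m_closed[OF Ns(1)] subgroup.m_inv_closed[OF Ns(1)] by blast
        ultimately show "y \<in> K" by (simp add: K_def)
      qed
      then show "n \<in> nrm K" using nc K by (intro nrmI)
    qed
    ultimately have "N <#> H \<subseteq> nrm K" using subgroup_nrm[OF K(2)] by (intro set_mult_subset)
    then have Kn: "K \<lhd> G" using K NH by (intro nrm_eq_carrier_imp_normal) auto
    have LK: "L \<subseteq> K" using Ln m Z by (auto simp: K_def)
    have "K <#> H \<subseteq> Z" using m Z by (intro set_mult_subset) (auto simp: K_def)
    then have "R K" using Kn LK Ln Z ZC by (auto simp: R_def K_def)
    then have "L = K" using L_greatest LK finite_subgroup[OF K(1)] card_seteq by blast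
    show ?thesis
    proof
      fix z assume z: "z \<in> Z"
      then have "z \<in> N <#> H" using NH ZC by blast
      then obtain n h where nh: "n \<in> N" "h \<in> H" "z = n \<otimes> h" unfolding set_mult_def by blast
      have c: "n \<in> carrier G" "h \<in> carrier G" using nh Ns HC by auto
      have "n = z \<otimes> inv h" using nh c by (simp add: m_assoc)
      moreover have "inv h \<in> Z" using nh m Z subgroup.m_inv_closed[OF H(1)] by blast
      ultimately have "n \<in> Z" using z subgroup.m_closed[OF Z(1)] by simp
      then have "n \<in> L" using nh \<open>L = K\<close> by (simp add: K_def)
      then show "z \<in> m" unfolding m_def set_mult_def using nh by blast
    qed
  qed
  \<comment> \<open>Dedekind's law in element form: maximality gives \<open>L W = G\<close>, and in
    \<open>x = l \<otimes> w\<close> the factor \<open>l\<close> lies in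
    \<open>m \<inter> X\<close>, hence in \<open>W\<close>.\<close>
  have "W \<subseteq> m \<or> W = X"
    if W: "subgroup X G" "subgroup W G" "H \<subseteq> W" "m \<inter> X \<subseteq> W" "W \<subseteq> X" for X W
  proof (rule ccontr)
    assume contra: "\<not> ?thesis"
    note LW = sub_mult[OF Ln(1) W(2)]
    have "m \<subseteq> L <#> W" unfolding m_def using W(3) by (intro mono_set_mult) auto
    then have LWG: "L <#> W = carrier G" using max[OF LW(1)] LW(3) contra by blast
    have "X \<subseteq> W"
    proof
      fix x assume x: "x \<in> X"
      then have "x \<in> L <#> W" using LWG subgroup.subset[OF W(1)] by blast
      then obtain l w where lw: "l \<in> L" "w \<in> W" "x = l \<otimes> w" unfolding set_mult_def by blast
      have c: "l \<in> carrier G" "w \<in> carrier G" using lw Ln Ns subgroup.subset[OF W(2)] by auto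
      have "l = x \<otimes> inv w" using lw c by (simp add: m_assoc)
      moreover have "inv w \<in> X" using lw W(5) subgroup.m_inv_closed[OF W(2)] by blast
      ultimately have "l \<in> X" using x subgroup.m_closed[OF W(1)] by simp
      then have "l \<in> W" using lw m W(4) by blast
      then show "x \<in> W" using lw subgroup.m_closed[OF W(2)] by blast
    qed
    then show False using contra W by blast
  qed
  moreover have "m \<subset> carrier G" using subgroup.subset[OF m(1)] Ln(4) by (auto simp: m_def)
  ultimately show ?thesis unfolding modular_coatom_def using m by blast
qed

lemma prime_order_solvable:
  assumes "prime (card (carrier G))"
  shows "solvable G"
proof -
  obtain x where x: "x \<in> carrier G" "x \<noteq> \<one>" using prime_card_ne_one[OF assms] one_closed by blast
  have "generate G {x} = carrier G"
    using subgroup_self assms x by (intro generate_singleton_prime)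
  then have "carrier G \<subseteq> cent (carrier G)" using generate_singleton_cent[OF x(1)] by simp
  then have "y \<otimes> z = z \<otimes> y" if "y \<in> carrier G" "z \<in> carrier G" for y z
    using that centD[of z "carrier G" y] by blast
  then interpret comm_group G by (intro group_comm_groupI)
  have "(derived G ^^ 1) (carrier G) = {\<one>}" using derived_eq_singleton by simp
  then show ?thesis unfolding solvable_iff_trivial_derived_seq by blast
qed

end

section \<open>From modular coatoms to solvability\<close>

lemma (in group_hom) subgroup_preimage:
  assumes "subgroup K H"
  shows "subgroup {x \<in> carrier G. h x \<in> K} G"
  using subgroup.one_closed[OF assms] subgroup.m_closed[OF assms] subgroup.m_inv_closed[OF assms]
  by (intro G.subgroupI) auto

text \<open>The quotient \<open>Q\<close> by a maximal normal subgroup \<open>N\<close> is simple,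
  and the coatom of the interval above \<open>N\<close> maps to a solvable modular coatom of
  \<open>Q\<close>, which must be trivial. So \<open>Q\<close> has prime order, and \<open>G\<close>
  is an extension of the solvable group \<open>N\<close> by \<open>Q\<close>.\<close>

lemma (in finite_group) solvable_if_proper_subgroups_solvable:
  assumes proper: "\<And>K. subgroup K G \<Longrightarrow> K \<noteq> carrier G \<Longrightarrow> solvable_seq G K"
    and mc: "\<And>N. subgroup N G \<Longrightarrow> N \<subset> carrier G \<Longrightarrow> \<exists>m. modular_coatom G N (carrier G) m"
  shows "solvable G"
proof -
  show ?thesis
  proof (cases "carrier G = {\<one>}")
    case True
    then show ?thesis unfolding solvable_def using solvable_seq.unity[of G] by simp
  next
    case False
    define P where "P N \<longleftrightarrow> N \<lhd> G \<and> N \<noteq> carrier G" for N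
    have "P {\<one>}" using one_is_normal False by (auto simp: P_def)
    moreover have "card N < Suc (card (carrier G))" if "P N" for N
      using that card_mono[OF finite_carrier subgroup.subset[OF normal_imp_subgroup]]
      by (auto simp: P_def less_Suc_eq_le)
    ultimately obtain N where N: "P N" and N_greatest: "\<And>B. P B \<Longrightarrow> card B \<le> card N"
      using ex_has_greatest_nat[of P _ card "Suc (card (carrier G))"] by blast
    have Nn: "N \<lhd> G" "N \<noteq> carrier G" using N by (auto simp: P_def)
    have Ns: "subgroup N G" "N \<subset> carrier G"
      using normal_imp_subgroup[OF Nn(1)] subgroup.subset[OF normal_imp_subgroup[OF Nn(1)]] Nn(2) by auto
    obtain m where m: "modular_coatom G N (carrier G) m" using mc[OF Ns] by blast
    note m = modular_coatomD[OF m]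
    define Q where "Q = G Mod N"
    define f where "f x = N #> x" for x
    interpret N: normal N G by (rule Nn(1))
    interpret Q: group Q unfolding Q_def by (rule N.factorgroup_is_group)
    interpret f: group_hom G Q f
      using N.r_coset_hom_Mod unfolding f_def Q_def[symmetric] by unfold_locales
    have Qc: "carrier Q = f ` carrier G" unfolding Q_def f_def by (rule carrier_FactGroup)
    have one_iff: "f x = \<one>\<^bsub>Q\<^esub> \<longleftrightarrow> x \<in> N" if "x \<in> carrier G" for x
      using that coset_join1[of N x] coset_join2[of x N] Ns by (auto simp: f_def Q_def)
    interpret Q: finite_group Q
      by unfold_locales (simp add: Qc finite_carrier)
    \<comment> \<open>Together with the image under \<open>f\<close>, this is the correspondence
      between subgroups of \<open>Q\<close> and subgroups of \<open>G\<close> that contain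
      \<open>N\<close>.\<close>
    define pre where "pre K = {x \<in> carrier G. f x \<in> K}" for K
    have pre: "subgroup (pre K) G" "N \<subseteq> pre K" "f ` pre K = K" if "subgroup K Q" for K
    proof -
      show "subgroup (pre K) G" unfolding pre_def by (rule f.subgroup_preimage[OF that])
      show "N \<subseteq> pre K"
        using Ns one_iff subgroup.one_closed[OF that] unfolding pre_def by fastforce
      show "f ` pre K = K" using subgroup.subset[OF that] unfolding pre_def Qc by blast
    qed
    have pre_img: "pre (f ` K) = K" if K: "subgroup K G" "N \<subseteq> K" for K
    proof
      show "K \<subseteq> pre (f ` K)" using subgroup.subset[OF K(1)] by (auto simp: pre_def)
      show "pre (f ` K) \<subseteq> K"
      proof
        fix x assume "x \<in> pre (f ` K)"
        then obtain y where xy: "x \<in> carrier G" "y \<in> K" "f x = f y" by (auto simp: pre_def)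
        have yc: "y \<in> carrier G" using xy subgroup.subset[OF K(1)] by blast
        have "f (x \<otimes> inv y) = \<one>\<^bsub>Q\<^esub>" using xy yc by simp
        then have "x \<otimes> inv y \<in> K" using one_iff[of "x \<otimes> inv y"] xy(1) yc K(2) by auto
        then have "x \<otimes> inv y \<otimes> y \<in> K" using xy subgroup.m_closed[OF K(1)] by blast
        then show "x \<in> K" using xy yc by (simp add: m_assoc)
      qed
    qed
    have simple: "K = {\<one>\<^bsub>Q\<^esub>} \<or> K = carrier Q" if K: "K \<lhd> Q" for K
    proof -
      have Ks: "subgroup K Q" using K normal_imp_subgroup by blast
      have "pre K \<lhd> G" unfolding normal_inv_iff
      proof (intro conjI ballI pre(1)[OF Ks])
        fix x y assume "x \<in> carrier G" "y \<in> pre K"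
        moreover from this have "f x \<otimes>\<^bsub>Q\<^esub> f y \<otimes>\<^bsub>Q\<^esub> inv\<^bsub>Q\<^esub> f x \<in> K"
          using K Q.normal_inv_iff by (auto simp: pre_def)
        ultimately show "x \<otimes> y \<otimes> inv x \<in> pre K" by (auto simp: pre_def)
      qed
      then have "pre K = carrier G \<or> pre K = N"
        using N_greatest[of "pre K"] pre[OF Ks] card_seteq[OF finite_subgroup[OF pre(1)[OF Ks]] pre(2)[OF Ks]]
        by (auto simp: P_def)
      then show ?thesis
      proof
        assume "pre K = carrier G"
        then show ?thesis using pre(3)[OF Ks] Qc by simp
      next
        assume "pre K = N"
        then have "K = f ` N" using pre(3)[OF Ks] by simp
        moreover have "f x = \<one>\<^bsub>Q\<^esub>" if "x \<in> N" for x using that one_iff Ns(2) by blast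
        ultimately have "K \<subseteq> {\<one>\<^bsub>Q\<^esub>}" by auto
        then show ?thesis using subgroup.one_closed[OF Ks] by blast
      qed
    qed
    have img: "subgroup (f ` m) Q" using m(1) by (rule f.subgroup_img_is_subgroup)
    have img_ne: "f ` m \<noteq> carrier Q"
    proof
      assume "f ` m = carrier Q"
      then have "pre (f ` m) = carrier G" using Qc by (auto simp: pre_def)
      then show False using pre_img[OF m(1,2)] m(3) by simp
    qed
    have img_modular: "W \<subseteq> f ` m \<or> W = X"
      if W: "subgroup X Q" "subgroup W Q" "f ` m \<inter> X \<subseteq> W" "W \<subseteq> X" for X W
    proof -
      have "m \<inter> pre X \<subseteq> pre W" using W(3) by (auto simp: pre_def)
      moreover have "pre W \<subseteq> pre X" using W(4) by (auto simp: pre_def)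
      moreover have "pre X \<subseteq> carrier G" by (auto simp: pre_def)
      ultimately have "pre W \<subseteq> m \<or> pre W = pre X"
        using m(4)[OF pre(1)[OF W(1)] pre(1)[OF W(2)] pre(2)[OF W(2)]] by blast
      then have "f ` pre W \<subseteq> f ` m \<or> f ` pre W = f ` pre X" by (auto simp: image_mono)
      then show ?thesis unfolding pre(3)[OF W(1)] pre(3)[OF W(2)] .
    qed
    interpret S: simple_group_modular_coatom Q "f ` m"
      using simple img img_ne img_modular Q.finite_group_axioms
      by (intro simple_group_modular_coatom.intro simple_group_modular_coatom_axioms.intro) simp_all
    have "solvable_seq Q (f ` m)"
      using proper[OF m(1)] m(3) by (intro f.solvable_imp_solvable_img) auto
    then have fm: "f ` m = {\<one>\<^bsub>Q\<^esub>}" by (rule S.solvable_imp_trivial)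
    \<comment> \<open>The trivial subgroup is maximal in \<open>Q\<close>, so no other proper
      subgroup exists.\<close>
    have "prime (card (carrier Q))"
    proof (rule Q.prime_card_if_minimal[OF Q.subgroup_self])
      show "carrier Q \<noteq> {\<one>\<^bsub>Q\<^esub>}" using fm img_ne by simp
    next
      fix R assume R: "subgroup R Q" "R \<subseteq> carrier Q"
      have "f ` m \<subseteq> R" using fm subgroup.one_closed[OF R(1)] by simp
      then show "R = {\<one>\<^bsub>Q\<^esub>} \<or> R = carrier Q" using S.overgroup_cases[OF R(1)] fm by simp
    qed
    then have "solvable Q" by (rule Q.prime_order_solvable)
    moreover have "solvable_seq G N" using proper Ns by blast
    \<comment> \<open>Exactness in the middle of the sequence \<open>N\<close>, \<open>G\<close>,
      \<open>Q\<close>, with \<open>id\<close> as the inclusion of \<open>N\<close>.\<close>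
    moreover have "kernel G Q f \<subseteq> id ` N" using one_iff by (auto simp: kernel_def)
    moreover have "group_hom G G id" by unfold_locales (auto simp: hom_def)
    ultimately show ?thesis
      using solvable_seq_condition[OF _ f.group_hom_axioms, of G id N "carrier G"] Ns(2) subgroup_self Qc
      by (simp add: solvable_def)
  qed
qed

text \<open>Induction on the order. Subgroups are restrictions of the carrier and keep the type of
  \<open>G\<close>, so the hypothesis applies to them; the quotient, whose type differs, was treated
  directly.\<close>

lemma modular_coatoms_imp_solvable:
  fixes G :: "('a, 'b) monoid_scheme"
  assumes "finite_group G"
    and "\<And>u v. subgroup u G \<Longrightarrow> subgroup v G \<Longrightarrow> u \<subset> v \<Longrightarrow> \<exists>m. modular_coatom G u v m"
  shows "solvable G"
  using assms
proof (induction "card (carrier G)" arbitrary: G rule: less_induct)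
  case less
  interpret finite_group G by fact
  note mc = less.prems(2)
  have proper: "solvable_seq G K" if K: "subgroup K G" "K \<noteq> carrier G" for K
  proof (rule solvable_restrict_imp[OF K(1)], rule less.hyps)
    have KC: "K \<subset> carrier G" using subgroup.subset[OF K(1)] K(2) by blast
    show "card (carrier (G\<lparr>carrier := K\<rparr>)) < card (carrier G)"
      using psubset_card_mono[OF finite_carrier KC] by simp
    show "finite_group (G\<lparr>carrier := K\<rparr>)"
      using subgroup_imp_group[OF K(1)] finite_subgroup[OF K(1)]
      by (simp add: finite_group_def finite_group_axioms_def)
    show "\<exists>m. modular_coatom (G\<lparr>carrier := K\<rparr>) u v m"
      if "subgroup u (G\<lparr>carrier := K\<rparr>)" "subgroup v (G\<lparr>carrier := K\<rparr>)" "u \<subset> v" for u v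
    proof -
      have uv: "subgroup u G" "subgroup v G" "v \<subseteq> K" using that subgroup_restrict_iff[OF K(1)] by auto
      show ?thesis using mc[OF uv(1,2) that(3)] modular_coatom_restrict_iff[OF K(1) uv(3)] by simp
    qed
  qed
  show ?case
    using proper mc[OF _ subgroup_self] by (rule solvable_if_proper_subgroups_solvable)
qed

theorem theorem1p7:
  fixes G :: "('a, 'b) monoid_scheme"
  assumes "group G" and "finite (carrier G)"
  shows "solvable G \<longleftrightarrow> comodernistic (subgroup_lattice G)"
proof -
  interpret finite_group G
    using assms by (simp add: finite_group_def finite_group_axioms_def)
  show ?thesis unfolding comodernistic_iff
  proof (intro iffI allI impI)
    fix u v assume sol: "solvable G" and u: "subgroup u G" and v: "subgroup v G" and uv: "u \<subset> v"
    interpret v: finite_group "G\<lparr>carrier := v\<rparr>"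
      using subgroup_imp_group[OF v] finite_subgroup[OF v]
      by (simp add: finite_group_def finite_group_axioms_def)
    \<comment> \<open>Taking \<open>v\<close> as the ambient group turns the top of the interval
      into the whole carrier.\<close>
    have "\<exists>m. modular_coatom (G\<lparr>carrier := v\<rparr>) u (carrier (G\<lparr>carrier := v\<rparr>)) m"
      using solvable_restrict[OF v sol] subgroup_restrict_iff[OF v] u uv
      by (intro v.solvable_exists_modular_coatom) auto
    then show "\<exists>m. modular_coatom G u v m" using modular_coatom_restrict_iff[OF v] by simp
  next
    assume "\<forall>u v. subgroup u G \<longrightarrow> subgroup v G \<longrightarrow> u \<subset> v \<longrightarrow> (\<exists>m. modular_coatom G u v m)"
    then show "solvable G" using modular_coatoms_imp_solvable[OF finite_group_axioms] by blast
  qed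
qed

end
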